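(* Let $N\ge 2$, $p>0$, and let $f\in C^1[0,\infty)$ be nondecreasing with $f(t)>0$ for all $t>0$; put $F(s)=\int_0^s f(t)\,dt$. Consider $$\Delta u=v^p,\qquad \Delta v=f(|\nabla u|)\qquad\text{in }\mathbb{R}^N. \tag{E}$$ (i) System (E) has positive radially symmetric solutions (defined in all of $\mathbb{R}^N$) if and only if $$\int_1^\infty\Big(\int_0^s F(t)\,dt\Big)^{-p/(2p+1)}ds=\infty.$$ (ii) Assume $f(t)=t^q$ with $q\ge 1>p$ and $pq<1$, and assume $$\frac{p(q^2-4)}{1-pq}\le 2(N-1).$$ Let $(u,v)$ be any positive radially symmetric solution of (E). Then $$\lim_{|x|\to\infty}\frac{u(x)}{|x|^{\frac{2+2p-pq}{1-pq}}}=\Big[\frac{(2+q)\big(N(1-pq)+p(2+q)\big)^{1/p}\big(N(1-pq)+q(2p+1)\big)}{(1-pq)^{\frac{2p+2-pq}{p}}(2+2p-pq)^{\frac{pq-1}{p}}}\Big]^{\frac{p}{pq-1}}$$ and $$\lim_{|x|\to\infty}\frac{v(x)}{|x|^{\frac{q+2}{1-pq}}}=\Big[\frac{(2+q)\big(N(1-pq)+p(2+q)\big)^{q}\big(N(1-pq)+q(2p+1)\big)}{(1-pq)^{2+q}}\Big]^{\frac{1}{pq-1}}.$$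
   Context: A positive radially symmetric solution of (E) is a pair of radially symmetric functions $u,v\in C^2(\mathbb{R}^N)$, positive everywhere, satisfying (E) pointwise in $\mathbb{R}^N$. *)

theory Defs
  imports "HOL-Analysis.Analysis"
begin

definition grad :: "(real^'n \<Rightarrow> real) \<Rightarrow> real^'n \<Rightarrow> real^'n" where
  "grad u x = (\<chi> i. frechet_derivative u (at x) (axis i 1))"

definition C2 :: "(real^'n \<Rightarrow> real) \<Rightarrow> bool" where
  "C2 u \<longleftrightarrow> (\<forall>x. u differentiable (at x)) \<and> (\<forall>x. grad u differentiable (at x)) \<and>
     (\<forall>i j. continuous_on UNIV (\<lambda>x. frechet_derivative (grad u) (at x) (axis j 1) $ i))"

definition laplacian :: "(real^'n \<Rightarrow> real) \<Rightarrow> real^'n \<Rightarrow> real" where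
  "laplacian u x = (\<Sum>i\<in>UNIV. frechet_derivative (grad u) (at x) (axis i 1) $ i)"

definition radial :: "(real^'n \<Rightarrow> real) \<Rightarrow> bool" where
  "radial u \<longleftrightarrow> (\<forall>x y. norm x = norm y \<longrightarrow> u x = u y)"

definition pos_rad_sol :: "real \<Rightarrow> (real \<Rightarrow> real) \<Rightarrow> (real^'n \<Rightarrow> real) \<Rightarrow> (real^'n \<Rightarrow> real) \<Rightarrow> bool" where
  "pos_rad_sol p f u v \<longleftrightarrow> C2 u \<and> C2 v \<and> radial u \<and> radial v \<and>
     (\<forall>x. u x > 0 \<and> v x > 0) \<and>
     (\<forall>x. laplacian u x = v x powr p) \<and>
     (\<forall>x. laplacian v x = f (norm (grad u x)))"

end

theory Submission
  imports Defs
begin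

text \<open>
  For radial functions the system reads $u' = w$, $w = M(v^p)$, $v' = M(f(w))$, where
  $M h(r) = r^{1-N} \int_0^r s^{N-1} h(s)\,ds$. If $h$ is nondecreasing, $h/N \le (M h)' \le h$, so
  up to constants $w' = v^p$ and $v'' = f(w)$. With $G'' = f$, $G(0) = G'(0) = 0$, one finds
  $v^p v' \sim G'(w)$ and hence $v^{2p+1} \sim G(w)$, so that $w' \sim G(w)^{p/(2p+1)}$: such a
  $w$ stays finite for all $r$ iff the integral diverges. The upper estimate
  also holds for the monotone Picard iterates, whose limit is then a global solution.

  For $f(t) = t^q$ the integral operator is monotone, and $V(r) = A r^a$ is its exact fixed point, while
  the translate $A (r + R)^a$ is a supersolution. A first-contact argument traps every solution $v$ with
  $v(0) < A R^a$ between the two, which have the same leading asymptotics.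
\<close>

section \<open>Spherical means\<close>

text \<open>The obstacle in the energy estimate: multiplying \<open>v'' ~ f(w)\<close> by
  \<open>v^p\<close> leaves the extra term \<open>p v^(p-1) v'^2\<close>. For the bound of
  \<open>G(w)\<close> by \<open>v^(2p+1)\<close> its sign is favourable; for the converse bound it
  is absorbed by \<open>v'^2 <= 2 \<phi> v\<close>, where \<phi> is the source of \<open>v\<close>.
  To serve solutions and iterates alike, \<phi> is kept separate from \<open>f(w)\<close>: each
  estimate asks for one inequality between the two, and increasing iterates satisfy
  \<open>\<phi> <= f(w)\<close>. Global existence then needs no continuation argument: the iterates
  live on the whole half line, and divergence of the integral bounds them on every compact interval,
  uniformly in the index.

  In the power case strictness comes from the initial value. At a would-be contact with
  \<open>A r^a\<close> the equation still leaves the margin \<open>V(0) > 0\<close>, while applying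
  the operator to the translate loses \<open>A R^a\<close>, which exceeds
  \<open>V(0)\<close>.\<close>

definition avg :: "nat \<Rightarrow> (real \<Rightarrow> real) \<Rightarrow> real \<Rightarrow> real" where
  "avg N h r = integral {0..r} (\<lambda>s. s^(N-1) * h s) / r^(N-1)"

text \<open>Replaces the integration of differential inequalities throughout. Derivatives are asked
  for only in the open interval, because at \<open>0\<close> the equation carries the singular term
  \<open>(N - 1) / r\<close>.\<close>

lemma increment_le_of_deriv_le:
  fixes \<phi> \<psi> :: "real \<Rightarrow> real"
  assumes "a \<le> b" "continuous_on {a..b} \<phi>" "continuous_on {a..b} \<psi>"
    and "\<And>x. a < x \<Longrightarrow> x < b \<Longrightarrow> (\<phi> has_real_derivative \<phi>' x) (at x)"
    and "\<And>x. a < x \<Longrightarrow> x < b \<Longrightarrow> (\<psi> has_real_derivative \<psi>' x) (at x)"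
    and "\<And>x. a < x \<Longrightarrow> x < b \<Longrightarrow> \<phi>' x \<le> \<psi>' x"
  shows "\<phi> b - \<phi> a \<le> \<psi> b - \<psi> a"
proof -
  have "(\<lambda>x. \<psi> x - \<phi> x) a \<le> (\<lambda>x. \<psi> x - \<phi> x) b"
  proof (rule DERIV_nonneg_imp_increasing_open[OF assms(1)])
    fix x assume x: "a < x" "x < b"
    show "\<exists>y. ((\<lambda>x. \<psi> x - \<phi> x) has_real_derivative y) (at x) \<and> 0 \<le> y"
      using DERIV_diff[OF assms(5)[OF x] assms(4)[OF x]] assms(6)[OF x] by force
  qed (use assms in \<open>auto intro: continuous_on_diff\<close>)
  then show ?thesis by simp
qed

text \<open>The integral over a point vanishes and so does the quotient, also when the divisor is
  \<open>0\<close>. This is the continuous value, matching \<open>u'(0) = 0\<close>.\<close>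

lemma avg_0 [simp]: "avg N h 0 = 0"
  by (simp add: avg_def)

lemma avg_cong:
  assumes "\<And>s. 0 \<le> s \<Longrightarrow> s \<le> r \<Longrightarrow> h s = k s"
  shows "avg N h r = avg N k r"
  unfolding avg_def using assms by (intro arg_cong2[where f="(/)"] integral_cong) auto

lemma weighted_integrable:
  fixes h :: "real \<Rightarrow> real"
  assumes "continuous_on {0..} h"
  shows "(\<lambda>s. s^m * h s) integrable_on {0..r}"
proof -
  have "continuous_on {0..r} h" using assms continuous_on_subset by fastforce
  then show ?thesis by (intro integrable_continuous_interval continuous_intros)
qed

lemma avg_mono:
  assumes "continuous_on {0..} h" "continuous_on {0..} k" "r \<ge> 0"
    and "\<And>s. 0 \<le> s \<Longrightarrow> s \<le> r \<Longrightarrow> h s \<le> k s"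
  shows "avg N h r \<le> avg N k r"
  unfolding avg_def using assms
  by (intro divide_right_mono integral_le weighted_integrable) (auto intro!: mult_left_mono)

lemma avg_const:
  assumes "N \<ge> 1" "r \<ge> 0"
  shows "avg N (\<lambda>_. c) r = c * r / N"
proof (cases "r = 0")
  case False
  then have r: "r > 0" using assms by simp
  have "((\<lambda>s. s^(N-1) * c) has_integral (c * r^N / N - c * 0^N / N)) {0..r}"
  proof (rule fundamental_theorem_of_calculus[OF assms(2)])
    fix x assume "x \<in> {0..r}"
    have "((\<lambda>s. c * s^N / N) has_real_derivative x^(N-1) * c) (at x within {0..r})"
      using assms by (auto intro!: derivative_eq_intros simp: field_simps)
    then show "((\<lambda>s. c * s^N / N) has_vector_derivative x^(N-1) * c) (at x within {0..r})"
      by (rule has_real_derivative_iff_has_vector_derivative[THEN iffD1])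
  qed
  then have "integral {0..r} (\<lambda>s. s^(N-1) * c) = c * r^N / N"
    using assms by (subst integral_unique) (auto simp: power_0_left)
  moreover have "r^N = r * r^(N-1)" using assms by (metis power_eq_if not_one_le_zero)
  ultimately show ?thesis using r by (simp add: avg_def)
qed simp

lemma integral_deriv_interior:
  fixes g :: "real \<Rightarrow> real"
  assumes "continuous_on {a..} g" "r > a"
  shows "((\<lambda>r. integral {a..r} g) has_real_derivative g r) (at r)"
proof -
  have "continuous_on {a..r+1} g" using assms continuous_on_subset by fastforce
  then have "((\<lambda>r. integral {a..r} g) has_real_derivative g r) (at r within {a..r+1})"
    using assms by (intro integral_has_real_derivative) auto
  moreover have "at r within {a..r+1} = at r"
    using assms by (intro at_within_interior) (auto simp: interior_atLeastAtMost_real)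
  ultimately show ?thesis by simp
qed

lemma integral_continuous:
  fixes g :: "real \<Rightarrow> real"
  assumes "\<And>r. g integrable_on {a..r}"
  shows "continuous_on {a..} (\<lambda>r. integral {a..r} g)"
proof -
  have "continuous (at x within {a..}) (\<lambda>r. integral {a..r} g)" if "x \<ge> a" for x
  proof -
    have "continuous_on {a..x+1} (\<lambda>r. integral {a..r} g)"
      by (rule indefinite_integral_continuous_1[OF assms])
    then have "continuous (at x within {a..x+1}) (\<lambda>r. integral {a..r} g)"
      using that by (auto simp: continuous_on_eq_continuous_within)
    moreover have "at x within {a..x+1} = at x within {a..}"
      by (rule at_within_nhd[of x "{x-1<..<x+1}"]) auto
    ultimately show ?thesis by simp
  qed
  then show ?thesis by (auto simp: continuous_on_eq_continuous_within)
qed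

lemma power_deriv:
  fixes x :: real
  assumes "x > 0"
  shows "((\<lambda>r. r^m) has_real_derivative real m * x^m / x) (at x)"
proof (cases m)
  case (Suc k)
  then show ?thesis using DERIV_pow[of m x UNIV] assms by simp
qed simp

lemma avg_deriv:
  assumes "N \<ge> 1" "continuous_on {0..} h" "r > 0"
  shows "(avg N h has_real_derivative h r - (real N - 1) * avg N h r / r) (at r)"
proof -
  have "continuous_on {0..} (\<lambda>s. s^(N-1) * h s)" by (intro continuous_intros assms)
  from integral_deriv_interior[OF this assms(3)]
  have "((\<lambda>r. integral {0..r} (\<lambda>s. s^(N-1) * h s)) has_real_derivative r^(N-1) * h r) (at r)" .
  moreover have "((\<lambda>r. r^(N-1)) has_real_derivative (real (N-1)) * r^(N-1) / r) (at r)"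
    by (rule power_deriv[OF assms(3)])
  ultimately have "((\<lambda>r. integral {0..r} (\<lambda>s. s^(N-1) * h s) / r^(N-1)) has_real_derivative 
     (r^(N-1) * h r * r^(N-1) - integral {0..r} (\<lambda>s. s^(N-1) * h s) * (real (N-1) * r^(N-1) / r)) / (r^(N-1) * r^(N-1))) (at r)"
    using assms(3) by (intro DERIV_divide) auto
  moreover have "(r^(N-1) * h r * r^(N-1) - integral {0..r} (\<lambda>s. s^(N-1) * h s) * (real (N-1) * r^(N-1) / r)) / (r^(N-1) * r^(N-1))
     = h r - (real N - 1) * avg N h r / r"
    using assms by (simp add: avg_def field_simps of_nat_diff)
  ultimately show ?thesis by (simp add: avg_def[abs_def])
qed

text \<open>Near \<open>0\<close> the function \<open>h\<close> lies between two constants, whose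
  means are known exactly. The limit is that of \<open>u'(r) / r\<close>, which decides second-order
  differentiability at the origin.\<close>

lemma avg_div_tendsto:
  assumes "N \<ge> 1" "continuous_on {0..} h"
  shows "((\<lambda>r. avg N h r / r) \<longlongrightarrow> h 0 / N) (at_right 0)"
proof (rule tendstoI)
  fix e :: real assume e: "e > 0"
  have "(h \<longlongrightarrow> h 0) (at 0 within {0..})"
    using assms(2) by (auto simp: continuous_on_def)
  then obtain d where d: "d > 0" "\<And>s. s \<in> {0..} \<Longrightarrow> s \<noteq> 0 \<Longrightarrow> dist s 0 < d \<Longrightarrow> dist (h s) (h 0) < e/2"
    using e by (auto dest!: tendstoD[where e="e/2"] simp: eventually_at)
  have near: "\<bar>h s - h 0\<bar> \<le> e/2" if "0 \<le> s" "s < d" for s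
    using d(2)[of s] that e by (cases "s = 0") (auto simp: dist_real_def)
  have "dist (avg N h r / r) (h 0 / N) < e" if r: "0 < r" "r < d" for r
  proof -
    have bd: "h s \<le> h 0 + e/2" "h 0 - e/2 \<le> h s" if "0 \<le> s" "s \<le> r" for s
      using near[of s] that r by linarith+
    have "avg N h r \<le> avg N (\<lambda>_. h 0 + e/2) r"
      using r bd by (intro avg_mono assms) auto
    moreover have "avg N (\<lambda>_. h 0 - e/2) r \<le> avg N h r"
      using r bd by (intro avg_mono assms) auto
    ultimately have "avg N h r / r \<le> (h 0 + e/2)/N" "(h 0 - e/2)/N \<le> avg N h r / r"
      using r assms(1) by (auto simp: avg_const field_simps)
    moreover have "e/2/N \<le> e/2" using assms(1) e by (simp add: field_simps)
    ultimately show ?thesis using e by (simp add: dist_real_def add_divide_distrib diff_divide_distrib)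
  qed
  then show "eventually (\<lambda>r. dist (avg N h r / r) (h 0 / N) < e) (at_right 0)"
    using d(1) by (auto simp: eventually_at_right_field)
qed

lemma avg_continuous:
  assumes "N \<ge> 1" "continuous_on {0..} h"
  shows "continuous_on {0..} (avg N h)"
proof -
  have "continuous (at x within {0..}) (avg N h)" if x: "x \<ge> 0" for x
  proof (cases "x = 0")
    case True
    have "((\<lambda>r. avg N h r / r * r) \<longlongrightarrow> h 0 / N * 0) (at_right 0)"
      by (rule tendsto_mult[OF avg_div_tendsto[OF assms] tendsto_ident_at])
    moreover have "eventually (\<lambda>r. avg N h r / r * r = avg N h r) (at_right 0)"
      by (auto simp: eventually_at_filter)
    ultimately have "(avg N h \<longlongrightarrow> 0) (at_right 0)"
      using Lim_transform_eventually by fastforce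
    then show ?thesis
      using True by (simp add: continuous_within at_within_Ici_at_right)
  next
    case False
    then show ?thesis using avg_deriv[OF assms, of x] x
      by (auto intro: continuous_at_imp_continuous_at_within DERIV_isCont)
  qed
  then show ?thesis by (auto simp: continuous_on_eq_continuous_within)
qed

text \<open>With the integrating factor \<open>s^(N-1)\<close> the difference to
  \<open>avg N h\<close> has derivative zero, and it vanishes at \<open>0\<close>. This singles out
  the regular solution of \<open>Y' + (N - 1) Y / s = h\<close>.\<close>

lemma avg_eqI:
  assumes "N \<ge> 1" "continuous_on {0..} h" "continuous_on {0..} Y" "Y 0 = 0" "r \<ge> 0"
    and "\<And>s. s > 0 \<Longrightarrow> (Y has_real_derivative h s - (real N - 1) * Y s / s) (at s)"
  shows "Y r = avg N h r"
proof (cases "r = 0")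
  case False
  then have r: "r > 0" using assms by simp
  define D where "D = (\<lambda>s. s^(N-1) * (Y s - avg N h s))"
  have "D r = D 0"
  proof (rule DERIV_isconst_end[OF r])
    have "continuous_on {0..} D"
      unfolding D_def by (intro continuous_intros avg_continuous assms)
    then show "continuous_on {0..r} D" using continuous_on_subset by fastforce
    fix x assume x: "0 < x" "x < r"
    have "((\<lambda>r. r^(N-1)) has_real_derivative (real (N-1)) * x^(N-1) / x) (at x)"
      by (rule power_deriv[OF x(1)])
    from DERIV_mult[OF this DERIV_diff[OF assms(6)[OF x(1)] avg_deriv[OF assms(1,2) x(1)]]]
    show "(D has_real_derivative 0) (at x)"
      unfolding D_def using assms(1) x by (auto elim!: DERIV_cong simp: field_simps of_nat_diff)
  qed
  moreover have "D 0 = 0" by (simp add: D_def assms)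
  ultimately have "D r = 0" by simp
  then show ?thesis using r by (simp add: D_def)
qed (use assms in simp)

section \<open>Radial functions\<close>

lemma grad_eqI:
  assumes "(u has_derivative (\<lambda>y. G \<bullet> y)) (at x)"
  shows "grad u x = G"
  unfolding grad_def frechet_derivative_at[OF assms, symmetric]
  by (simp add: vec_eq_iff inner_axis)

lemma filterlim_norm_at_right: "filterlim norm (at_right (0::real)) (at (0::'a::real_normed_vector))"
  unfolding filterlim_at
  by (auto simp: eventually_at_filter intro!: tendsto_eq_intros)

text \<open>Turns a radial integral equation back into a classical function: the gradient is
  \<open>g (norm x) *\<^sub>R x\<close> with \<open>g = u' / r\<close>, which extends continuously
  to the origin by \<open>avg_div_tendsto\<close>. The sign of \<open>h\<close> is free, hence the
  absolute value.\<close>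

lemma radial_lift:
  fixes h :: "real \<Rightarrow> real" and u :: "real^'n \<Rightarrow> real"
  defines "N \<equiv> CARD('n)"
  assumes h: "continuous_on {0..} h"
    and u: "\<And>x. u x = c + integral {0..norm x} (avg N h)"
  shows "C2 u" "radial u" "laplacian u x = h (norm x)" "norm (grad u x) = \<bar>avg N h (norm x)\<bar>"
proof -
  have N: "N \<ge> 1" by (simp add: N_def Suc_leI)
  define U where "U r = c + integral {0..r} (avg N h)" for r
  define g where "g r = (if r = 0 then h 0 / N else avg N h r / r)" for r
  \<comment> \<open>For \<open>r > 0\<close> this is \<open>r g'(r) = u'' - u' / r\<close>, the gap
    between the radial and the tangential eigenvalue of the Hessian.\<close>
  define k where "k r = h r - N * g r" for r
  note cA = avg_continuous[OF N h]
  have avg_g: "avg N h r = r * g r" for r by (simp add: g_def)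
  have g0: "(g \<longlongrightarrow> g 0) (at_right 0)"
  proof -
    have "eventually (\<lambda>r. avg N h r / r = g r) (at_right 0)"
      by (auto simp: eventually_at_filter g_def)
    with avg_div_tendsto[OF N h] show ?thesis
      using Lim_transform_eventually by (fastforce simp: g_def)
  qed
  have g': "(g has_real_derivative k r / r) (at r)" if "r > 0" for r
  proof -
    have "((\<lambda>r. avg N h r / r) has_real_derivative ((h r - (real N - 1) * avg N h r / r) * r - avg N h r * 1) / (r * r)) (at r)"
      using that by (intro DERIV_divide avg_deriv N h DERIV_ident) auto
    moreover have "((h r - (real N - 1) * avg N h r / r) * r - avg N h r * 1) / (r * r) = k r / r"
      using that by (simp add: k_def g_def field_simps)
    ultimately have "((\<lambda>r. avg N h r / r) has_real_derivative k r / r) (at r)" by simp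
    then show ?thesis
      by (rule has_field_derivative_transform_within[OF _ that]) (use that in \<open>auto simp: g_def dist_real_def\<close>)
  qed
  have cg: "continuous_on {0..} g"
  proof -
    have "continuous (at x within {0..}) g" if "x \<ge> 0" for x
    proof (cases "x = 0")
      case True then show ?thesis using g0 by (simp add: continuous_within at_within_Ici_at_right)
    next
      case False then show ?thesis using g'[of x] that
        by (auto intro: continuous_at_imp_continuous_at_within DERIV_isCont)
    qed
    then show ?thesis by (auto simp: continuous_on_eq_continuous_within)
  qed
  have ck: "continuous_on {0..} k" unfolding k_def by (intro continuous_intros cg h)
  have cgn: "continuous_on UNIV (\<lambda>x::real^'n. g (norm x))"
    by (rule continuous_on_compose2[OF cg]) (auto intro: continuous_intros)
  have ckn: "continuous_on UNIV (\<lambda>x::real^'n. k (norm x))"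
    by (rule continuous_on_compose2[OF ck]) (auto intro: continuous_intros)
  have k0: "k 0 = 0" using N by (simp add: k_def g_def)
  have cA': "continuous_on {0..1} (avg N h)" using cA continuous_on_subset by fastforce
  have U0: "((\<lambda>r. (U r - U 0) / r) \<longlongrightarrow> 0) (at_right 0)"
  proof -
    have "((\<lambda>r. integral {0..r} (avg N h)) has_real_derivative avg N h 0) (at 0 within {0..1})"
      by (intro integral_has_real_derivative cA') auto
    then have "((\<lambda>r. (U r - U 0) / r) \<longlongrightarrow> 0) (at 0 within {0..1})"
      by (simp add: has_field_derivative_iff U_def)
    moreover have "at (0::real) within {0..1} = at_right 0" by (simp add: at_within_Icc_at_right)
    ultimately show ?thesis by simp
  qed
  have U': "(U has_real_derivative r * g r) (at r)" if "r > 0" for r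
    unfolding U_def using integral_deriv_interior[OF cA that] 
    by (auto intro!: derivative_eq_intros simp: avg_g)
  have uU: "u = (\<lambda>x. U (norm x))" using u by (auto simp: U_def)
  have du: "(u has_derivative (\<lambda>y. (g (norm x) *\<^sub>R x) \<bullet> y)) (at x)" for x
  proof (cases "x = 0")
    case True
    have "((\<lambda>y::real^'n. (U (norm y) - U 0) / norm y) \<longlongrightarrow> 0) (at 0)"
      by (rule filterlim_compose[OF U0 filterlim_norm_at_right])
    then show ?thesis using True
      by (simp add: has_derivative_at_within uU divide_inverse mult.commute)
  next
    case False
    then have "((\<lambda>x. U (norm x)) has_derivative (\<lambda>y. (norm x * g (norm x)) * (y \<bullet> sgn x))) (at x)"
      by (intro has_derivative_compose[OF has_derivative_norm U'[unfolded has_field_derivative_def]]) auto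
    then show ?thesis unfolding uU
      by (rule has_derivative_eq_rhs) (use False in \<open>auto simp: fun_eq_iff sgn_div_norm inner_commute\<close>)
  qed
  have gr: "grad u = (\<lambda>x. g (norm x) *\<^sub>R x)" using grad_eqI[OF du] by auto
  \<comment> \<open>The Hessian \<open>g I + k x x^T / |x|^2\<close>; at \<open>x = 0\<close> the
    second summand is zero and \<open>g 0\<close> times the identity remains.\<close>
  define D where "D x y = g (norm x) *\<^sub>R y + (k (norm x) * (x \<bullet> y) / (norm x)^2) *\<^sub>R x" for x y :: "real^'n"
  have dg: "(grad u has_derivative D x) (at x)" for x
  proof (cases "x = 0")
    case True
    have "((\<lambda>y::real^'n. g (norm y)) \<longlongrightarrow> g 0) (at 0)"
      by (rule filterlim_compose[OF g0 filterlim_norm_at_right])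
    then have "((\<lambda>y::real^'n. \<bar>g (norm y) - g 0\<bar>) \<longlongrightarrow> 0) (at 0)"
      by (intro tendsto_rabs_zero) (simp add: LIM_zero)
    moreover have "eventually (\<lambda>y::real^'n. \<bar>g (norm y) - g 0\<bar> = norm ((g (norm y) *\<^sub>R y - g 0 *\<^sub>R y) /\<^sub>R norm y)) (at 0)"
      by (intro eventually_at_filter[THEN iffD2] always_eventually)
         (auto simp: scaleR_diff_left[symmetric] abs_mult)
    ultimately have "((\<lambda>y::real^'n. norm ((g (norm y) *\<^sub>R y - g 0 *\<^sub>R y) /\<^sub>R norm y)) \<longlongrightarrow> 0) (at 0)"
      using Lim_transform_eventually by fastforce
    then have "((\<lambda>y::real^'n. ((g (norm y) *\<^sub>R y - g 0 *\<^sub>R y) /\<^sub>R norm y)) \<longlongrightarrow> 0) (at 0)"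
      by (rule tendsto_norm_zero_cancel)
    moreover have "D 0 = (\<lambda>y. g 0 *\<^sub>R y)" by (auto simp: D_def)
    ultimately show ?thesis using True
      by (simp add: has_derivative_at_within gr bounded_linear_scaleR_right)
  next
    case False
    have *: "((\<lambda>x. g (norm x)) has_derivative (\<lambda>y. (k (norm x) / norm x) * (y \<bullet> sgn x))) (at x)"
      using False
      by (intro has_derivative_compose[OF has_derivative_norm g'[unfolded has_field_derivative_def]]) auto
    show ?thesis unfolding gr
      by (rule has_derivative_eq_rhs[OF has_derivative_scaleR[OF * has_derivative_ident]])
        (use False in \<open>auto simp: fun_eq_iff D_def sgn_div_norm inner_commute power2_eq_square field_simps\<close>)
  qed
  have fg: "frechet_derivative (grad u) (at x) = D x" for x
    using frechet_derivative_at[OF dg] by simp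
  have "continuous_on UNIV (\<lambda>x. D x (axis j 1) $ i)" for i j
  proof -
    \<comment> \<open>The directional factor is bounded but need not converge at the origin;
      continuity there rests on \<open>k 0 = 0\<close>.\<close>
    have "isCont (\<lambda>x. k (norm x) * (x$j * x$i / (norm x)^2)) x" for x :: "real^'n"
    proof (cases "x = 0")
      case False
      have "isCont (\<lambda>x::real^'n. k (norm x)) x" using ckn by (simp add: continuous_on_eq_continuous_at)
      then show ?thesis using False by (intro continuous_intros) auto
    next
      case True
      have "((\<lambda>x::real^'n. k (norm x)) \<longlongrightarrow> 0) (at 0)"
        using ckn k0 unfolding continuous_on_eq_continuous_at[OF open_UNIV] isCont_def
        by (metis UNIV_I norm_zero)
      then have "((\<lambda>x. k (norm x) * (x$j * x$i / (norm x)^2)) \<longlongrightarrow> 0) (at (0::real^'n))"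
      proof (rule Lim_null_comparison[rotated, OF tendsto_rabs_zero])
        have "norm (k (norm x) * (x$j * x$i / (norm x)^2)) \<le> \<bar>k (norm x)\<bar>" for x :: "real^'n"
        proof -
          have "\<bar>x$j\<bar> * \<bar>x$i\<bar> \<le> norm x * norm x"
            by (intro mult_mono component_le_norm_cart) auto
          then have "\<bar>x$j * x$i / (norm x)^2\<bar> \<le> 1"
            by (cases "x = 0") (auto simp: abs_mult power2_eq_square field_simps)
          then show ?thesis unfolding real_norm_def abs_mult by (rule mult_left_le) simp
        qed
        then show "\<forall>\<^sub>F x in at (0::real^'n). norm (k (norm x) * (x$j * x$i / (norm x)^2)) \<le> \<bar>k (norm x)\<bar>"
          by simp
      qed
      then show ?thesis using True k0 by (simp add: isCont_def)
    qed
    then have cs: "continuous_on UNIV (\<lambda>x::real^'n. k (norm x) * (x$j * x$i / (norm x)^2))"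
      by (simp add: continuous_on_eq_continuous_at)
    have "continuous_on UNIV (\<lambda>x::real^'n. g (norm x) * (axis j 1 :: real^'n) $ i + k (norm x) * (x$j * x$i / (norm x)^2))"
      by (intro continuous_on_add continuous_on_mult continuous_on_const cgn cs)
    moreover have Dc: "(\<lambda>x. D x (axis j 1) $ i) = (\<lambda>x::real^'n. g (norm x) * (axis j 1 :: real^'n) $ i + k (norm x) * (x$j * x$i / (norm x)^2))"
      by (auto simp: D_def inner_axis)
    ultimately show ?thesis by (simp only: Dc)
  qed
  then show "C2 u"
    unfolding C2_def fg differentiable_def using du dg by blast
  show "radial u" by (simp add: radial_def uU)
  show "norm (grad u x) = \<bar>avg N h (norm x)\<bar>" by (simp add: gr avg_g abs_mult)
  have "laplacian u x = (\<Sum>i\<in>UNIV. g (norm x) + k (norm x) / (norm x)^2 * (x$i * x$i))"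
    unfolding laplacian_def fg by (intro sum.cong) (auto simp: D_def inner_axis)
  also have "\<dots> = N * g (norm x) + k (norm x) / (norm x)^2 * (\<Sum>i\<in>UNIV. x$i * x$i)"
    by (simp add: sum.distrib sum_distrib_left N_def)
  also have "(\<Sum>i\<in>UNIV. x$i * x$i) = (norm x)^2"
    by (simp add: power2_norm_eq_inner inner_vec_def)
  also have "N * g (norm x) + k (norm x) / (norm x)^2 * (norm x)^2 = h (norm x)"
    using k0 N by (cases "x = 0") (auto simp: k_def g_def)
  finally show "laplacian u x = h (norm x)" .
qed

lemma even_deriv_zero:
  fixes \<phi> :: "real \<Rightarrow> real"
  assumes "(\<phi> has_real_derivative d) (at 0)" "\<And>t. \<phi> (-t) = \<phi> t"
  shows "d = 0"
proof -
  have "((\<lambda>t. \<phi> (-t)) has_real_derivative d * -1) (at 0)"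
    by (rule DERIV_chain2[of \<phi>]) (use assms in \<open>auto intro!: derivative_eq_intros\<close>)
  then have "(\<phi> has_real_derivative - d) (at 0)" unfolding assms(2) by simp
  then have "d = - d" by (rule DERIV_unique[OF assms(1)])
  then show ?thesis by simp
qed

text \<open>The axis \<open>k\<close> is merely a ray on which profiles are read. The Laplacian
  splits into the second derivative along the ray and \<open>N - 1\<close> equal transversal ones
  \<open>W / r\<close>, so that \<open>avg_eqI\<close> applies to the radial derivative
  \<open>W\<close>.\<close>

lemma radial_ode:
  fixes u :: "real^'n \<Rightarrow> real" and k :: 'n
  assumes C2: "C2 u" and rad: "radial u"
  defines "N \<equiv> CARD('n)" and "K \<equiv> \<lambda>r. laplacian u (r *\<^sub>R axis k 1)"
  shows "continuous_on {0..} K"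
    and "u x = u 0 + integral {0..norm x} (avg N K)"
    and "norm (grad u x) = \<bar>avg N K (norm x)\<bar>"
proof -
  define e :: "real^'n" where "e = axis k 1"
  have ne: "norm e = 1" by (simp add: e_def)
  define U where "U r = u (r *\<^sub>R e)" for r
  define W where "W r = grad u (r *\<^sub>R e) $ k" for r
  define H where "H x = frechet_derivative (grad u) (at x)" for x
  have N: "N \<ge> 1" by (simp add: N_def Suc_leI)
  have uU: "u x = U (norm x)" for x
  proof -
    have "norm x = norm (norm x *\<^sub>R e)" by (simp add: ne)
    then show ?thesis using rad unfolding U_def radial_def by blast
  qed
  have Uu: "u (r *\<^sub>R axis i 1) = U r" for i r
  proof -
    have "norm (r *\<^sub>R axis i 1 :: real^'n) = norm (r *\<^sub>R e)" by (simp add: ne)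
    then show ?thesis using rad unfolding U_def radial_def by blast
  qed
  have du: "(u has_derivative frechet_derivative u (at x)) (at x)" for x
    using C2 by (simp add: C2_def frechet_derivative_works)
  have dg: "(grad u has_derivative H x) (at x)" for x
    using C2 by (simp add: C2_def frechet_derivative_works H_def)
  have line: "((\<lambda>t. x + t *\<^sub>R axis i 1) has_derivative (\<lambda>t. t *\<^sub>R axis i 1)) (at t)" for x :: "real^'n" and i t
    by (auto intro!: derivative_eq_intros)
  have du_line: "((\<lambda>t. u (x + t *\<^sub>R axis i 1)) has_real_derivative grad u (x + t *\<^sub>R axis i 1) $ i) (at t)" for x i t
  proof -
    have "linear (frechet_derivative u (at (x + t *\<^sub>R axis i 1)))"
      using du has_derivative_linear by blast
    from linear_scale[OF this] show ?thesis
      unfolding has_field_derivative_def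
      by (intro has_derivative_eq_rhs[OF has_derivative_compose[OF line[of x i t] du]]) (auto simp: grad_def)
  qed
  have dg_line: "((\<lambda>t. grad u (x + t *\<^sub>R axis i 1) $ j) has_real_derivative H (x + t *\<^sub>R axis i 1) (axis i 1) $ j) (at t)" for x i t j
  proof -
    have "linear (H (x + t *\<^sub>R axis i 1))"
      using dg has_derivative_linear by blast
    from linear_scale[OF this] show ?thesis
      unfolding has_field_derivative_def
      by (intro has_derivative_eq_rhs[OF bounded_linear.has_derivative[OF bounded_linear_vec_nth
            has_derivative_compose[OF line[of x i t] dg]]]) auto
  qed
  have U': "(U has_real_derivative W r) (at r)" for r
    using du_line[of 0 k r] by (simp add: U_def[abs_def] W_def e_def)
  have W': "(W has_real_derivative H (r *\<^sub>R e) e $ k) (at r)" for r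
    using dg_line[of 0 k k r] by (simp add: W_def[abs_def] e_def)
  \<comment> \<open>A radial function is even along every axis.\<close>
  have grad0: "grad u 0 $ i = 0" for i
    using du_line[of 0 i 0] by (intro even_deriv_zero[of "\<lambda>t. u (t *\<^sub>R axis i 1)"]) (auto simp: Uu uU)
  then have W0: "W 0 = 0" by (simp add: W_def)
  have grad: "grad u x = (W (norm x) / norm x) *\<^sub>R x" for x
  proof (cases "x = 0")
    case False
    have "((\<lambda>x. U (norm x)) has_derivative (\<lambda>y. W (norm x) * (y \<bullet> sgn x))) (at x)"
      using False by (intro has_derivative_compose[OF has_derivative_norm U'[unfolded has_field_derivative_def]]) auto
    moreover have "(\<lambda>x. U (norm x)) = u" using uU by auto
    ultimately show ?thesis
      by (intro grad_eqI) (simp add: sgn_div_norm inner_commute divide_inverse mult.commute mult.left_commute)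
  next
    case True
    have "grad u 0 = 0" using grad0 by (simp add: vec_eq_iff)
    then show ?thesis using True by simp
  qed
  have Wc: "isCont W r" for r using W' by (blast intro: DERIV_isCont)
  \<comment> \<open>On the line through \<open>r *\<^sub>R e\<close> in a transversal direction,
    this gradient component is \<open>t\<close> times the continuous function
    \<open>W (\<rho> t) / \<rho> t\<close>. Caratheodory's criterion gives its derivative at
    \<open>t = 0\<close> without differentiating \<rho>.\<close>
  have off: "H (r *\<^sub>R e) (axis i 1) $ i = W r / r" if "i \<noteq> k" "r > 0" for i r
  proof -
    define \<rho> where "\<rho> t = norm (r *\<^sub>R e + t *\<^sub>R axis i 1)" for t
    have \<rho>0: "\<rho> 0 = r" using that by (simp add: \<rho>_def ne)
    have "isCont \<rho> 0" unfolding \<rho>_def by (intro continuous_intros)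
    then have "isCont (\<lambda>t. W (\<rho> t) / \<rho> t) 0"
      using that Wc by (intro continuous_intros isCont_o2[of _ \<rho> W]) (auto simp: \<rho>0)
    moreover have gt: "grad u (r *\<^sub>R e + t *\<^sub>R axis i 1) $ i = W (\<rho> t) / \<rho> t * t" for t
      using that by (simp add: grad \<rho>_def e_def axis_def)
    ultimately have "((\<lambda>t. grad u (r *\<^sub>R e + t *\<^sub>R axis i 1) $ i) has_real_derivative W (\<rho> 0) / \<rho> 0) (at 0)"
      unfolding CARAT_DERIV gt by (intro exI[of _ "\<lambda>t. W (\<rho> t) / \<rho> t"]) auto
    moreover have "((\<lambda>t. grad u (r *\<^sub>R e + t *\<^sub>R axis i 1) $ i) has_real_derivative H (r *\<^sub>R e) (axis i 1) $ i) (at 0)"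
      using dg_line[of "r *\<^sub>R e" i i 0] by simp
    ultimately show ?thesis by (simp add: \<rho>0 DERIV_unique)
  qed
  have lap: "K r = H (r *\<^sub>R e) e $ k + (real N - 1) * W r / r" if "r > 0" for r
  proof -
    have "K r = (\<Sum>i\<in>UNIV. H (r *\<^sub>R e) (axis i 1) $ i)"
      by (simp add: K_def laplacian_def H_def e_def)
    also have "\<dots> = H (r *\<^sub>R e) e $ k + (\<Sum>i\<in>UNIV-{k}. H (r *\<^sub>R e) (axis i 1) $ i)"
      by (subst sum.remove[of _ k]) (auto simp: e_def)
    also have "(\<Sum>i\<in>UNIV-{k}. H (r *\<^sub>R e) (axis i 1) $ i) = (\<Sum>i\<in>UNIV-{k}. W r / r)"
      using off that by (intro sum.cong) auto
    also have "\<dots> = (real N - 1) * W r / r"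
      using N by (simp add: card_Diff_singleton N_def of_nat_diff)
    finally show ?thesis .
  qed
  have "continuous_on UNIV (laplacian u)"
    unfolding laplacian_def[abs_def] using C2 by (intro continuous_on_sum) (simp add: C2_def)
  then show K: "continuous_on {0..} K"
    unfolding K_def by (rule continuous_on_compose2) (auto intro!: continuous_intros)
  have W_avg: "W r = avg N K r" if "r \<ge> 0" for r
  proof (rule avg_eqI[where Y = W, OF N K _ W0 that])
    show "continuous_on {0..} W" using Wc by (intro continuous_at_imp_continuous_on) auto
    show "(W has_real_derivative K s - (real N - 1) * W s / s) (at s)" if "s > 0" for s
      using W'[of s] lap[OF that] by simp
  qed
  have "(W has_integral (U (norm x) - U 0)) {0..norm x}"
    using U' by (intro fundamental_theorem_of_calculus)
      (auto simp: has_real_derivative_iff_has_vector_derivative[symmetric] intro: has_field_derivative_at_within)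
  then have "integral {0..norm x} W = U (norm x) - U 0" by (rule integral_unique)
  moreover have "integral {0..norm x} W = integral {0..norm x} (avg N K)"
    by (intro integral_cong) (auto simp: W_avg)
  ultimately show "u x = u 0 + integral {0..norm x} (avg N K)"
    by (simp add: uU)
  show "norm (grad u x) = \<bar>avg N K (norm x)\<bar>"
    using W0 by (cases "x = 0") (auto simp: grad W_avg)
qed

section \<open>Comparison with power solutions\<close>

text \<open>Comparison version of \<open>avg_eqI\<close>: after weighting by \<open>s^(N-1)\<close>
  the difference \<open>Y - avg N h\<close> is nondecreasing.\<close>

lemma avg_leI:
  assumes "N \<ge> 1" "continuous_on {0..} h" "continuous_on {0..} Y" "Y 0 \<ge> 0" "r \<ge> 0"
    and "\<And>s. s > 0 \<Longrightarrow> (Y has_real_derivative Y' s) (at s)"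
    and "\<And>s. s > 0 \<Longrightarrow> h s \<le> Y' s + (real N - 1) * Y s / s"
  shows "avg N h r \<le> Y r"
proof (cases "r = 0")
  case False
  then have r: "r > 0" using assms by simp
  have "0 - 0 \<le> r^(N-1) * (Y r - avg N h r) - 0^(N-1) * (Y 0 - avg N h 0)"
  proof (rule increment_le_of_deriv_le[where \<phi> = "\<lambda>_. 0" and \<psi> = "\<lambda>s. s^(N-1) * (Y s - avg N h s)"])
    have "continuous_on {0..} (\<lambda>s. s^(N-1) * (Y s - avg N h s))"
      by (intro continuous_intros avg_continuous assms)
    then show "continuous_on {0..r} (\<lambda>s. s^(N-1) * (Y s - avg N h s))" using continuous_on_subset by fastforce
    fix s assume s: "0 < s" "s < r"
    from DERIV_mult[OF power_deriv[OF s(1), of "N-1"] DERIV_diff[OF assms(6)[OF s(1)] avg_deriv[OF assms(1,2) s(1)]]]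
    show "((\<lambda>s. s^(N-1) * (Y s - avg N h s)) has_real_derivative
       s^(N-1) * (Y' s + (real N - 1) * Y s / s - h s)) (at s)"
      using assms(1) s by (auto elim!: DERIV_cong simp: field_simps of_nat_diff)
    show "0 \<le> s^(N-1) * (Y' s + (real N - 1) * Y s / s - h s)"
      using assms(7)[OF s(1)] s by simp
  qed (use assms in auto)
  moreover have "0^(N-1) * (Y 0 - avg N h 0) \<ge> 0" using assms by simp
  ultimately have "r^(N-1) * (Y r - avg N h r) \<ge> 0" by linarith
  moreover have "r^(N-1) > 0" using r by simp
  ultimately have "Y r - avg N h r \<ge> 0" by (meson mult_pos_neg not_le)
  then show ?thesis by simp
qed (use assms in simp)

lemma avg_cmult: "avg N (\<lambda>s. c * h s) r = c * avg N h r"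
proof -
  have "integral {0..r} (\<lambda>s. s^(N-1) * (c * h s)) = c * integral {0..r} (\<lambda>s. s^(N-1) * h s)"
    by (subst integral_mult_right[symmetric]) (simp add: mult.left_commute)
  then show ?thesis by (simp add: avg_def)
qed

section \<open>Means of powers and shifted powers; first contact\<close>

lemma continuous_on_powr_nonneg:
  fixes l :: "real \<Rightarrow> real"
  assumes "continuous_on S l" "\<And>s. s \<in> S \<Longrightarrow> 0 \<le> l s" "p > 0"
  shows "continuous_on S (\<lambda>s. l s powr p)"
  using assms by (intro continuous_on_powr' continuous_on_const) auto

lemma shift_powr_deriv:
  assumes "s + R > (0::real)"
  shows "((\<lambda>s. c * (s + R) powr e) has_real_derivative c * (e * (s + R) powr (e - 1))) (at s within A)"
  using assms by (auto intro!: derivative_eq_intros)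

lemma shift_powr_continuous:
  assumes "e > 0" "R \<ge> 0"
  shows "continuous_on {0::real..} (\<lambda>s. (s + R) powr e)"
  using assms by (intro continuous_on_powr' continuous_intros) auto

lemma avg_powr:
  assumes "N \<ge> 1" "e > 0" "r \<ge> 0"
  shows "avg N (\<lambda>s. s powr e) r = r powr (e + 1) / (N + e)"
proof (rule avg_eqI[where Y = "\<lambda>s. s powr (e + 1) / (N + e)", symmetric])
  fix s :: real assume s: "s > 0"
  have "((\<lambda>s. s powr (e + 1) / (N + e)) has_real_derivative (e + 1) * s powr e / (N + e)) (at s)"
    using s assms by (auto intro!: derivative_eq_intros)
  moreover have "(e + 1) * s powr e / (N + e) = s powr e - (real N - 1) * (s powr (e + 1) / (N + e)) / s"
  proof -
    define M where "M = N + e"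
    have M: "M > 0" using assms by (auto simp: M_def)
    have "(real N - 1) * (s powr (e + 1) / M) / s = (real N - 1) * s powr e / M"
      using s by (simp add: powr_add)
    moreover have "(e + 1) * s powr e + (real N - 1) * s powr e = s powr e * M"
      by (simp add: M_def algebra_simps)
    then have "(e + 1) * s powr e / M + (real N - 1) * s powr e / M = s powr e"
      using M by (simp add: add_divide_distrib[symmetric])
    ultimately show ?thesis unfolding M_def[symmetric] by linarith
  qed
  ultimately show "((\<lambda>s. s powr (e + 1) / (N + e)) has_real_derivative 
      s powr e - (real N - 1) * (s powr (e + 1) / (N + e)) / s) (at s)" by simp
next
  show "continuous_on {0..} (\<lambda>s::real. s powr e)" using assms by (intro continuous_on_powr_nonneg continuous_on_id) auto
  show "continuous_on {0..} (\<lambda>s::real. s powr (e + 1) / (N + e))" 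
    using assms by (intro continuous_on_divide continuous_on_const continuous_on_powr_nonneg continuous_on_id) auto
qed (use assms in auto)

text \<open>The shifted power is a supersolution because the term \<open>(N - 1) Y / s\<close> has
  \<open>s\<close>, and not the larger \<open>s + R\<close>, in the denominator; with
  \<open>s + R\<close> there would be equality.\<close>

lemma avg_shift_powr_le:
  assumes "N \<ge> 1" "e > 0" "r \<ge> 0" "R > 0"
  shows "avg N (\<lambda>s. (s + R) powr e) r \<le> (r + R) powr (e + 1) / (N + e)"
proof (rule avg_leI[where Y = "\<lambda>s. (s + R) powr (e + 1) / (N + e)" and Y' = "\<lambda>s. (e + 1) * (s + R) powr e / (N + e)"])
  fix s :: real assume s: "s > 0"
  show "((\<lambda>s. (s + R) powr (e + 1) / (N + e)) has_real_derivative (e + 1) * (s + R) powr e / (N + e)) (at s)"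
    using shift_powr_deriv[of s R "1 / (N + e)" "e + 1"] s assms by simp
  have "(N + e) * (s + R) powr e \<le> (e + 1) * (s + R) powr e + (real N - 1) * ((s + R) / s) * (s + R) powr e"
  proof -
    have "(real N - 1) * 1 \<le> (real N - 1) * ((s + R) / s)"
      using s assms by (intro mult_left_mono) auto
    then have "N + e \<le> e + 1 + (real N - 1) * ((s + R) / s)" by simp
    from mult_right_mono[OF this, of "(s + R) powr e"] show ?thesis by (simp add: algebra_simps)
  qed
  also have "\<dots> = (N + e) * ((e + 1) * (s + R) powr e / (N + e) + (real N - 1) * ((s + R) powr (e + 1) / (N + e)) / s)"
  proof -
    define M where "M = N + e"
    have "M > 0" using assms by (auto simp: M_def)
    then show ?thesis using s assms unfolding M_def[symmetric] by (simp add: powr_add field_simps)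
  qed
  finally show "(s + R) powr e \<le> (e + 1) * (s + R) powr e / (N + e) + (real N - 1) * ((s + R) powr (e + 1) / (N + e)) / s"
    using assms by (subst (asm) mult_le_cancel_left_pos) auto
next
  show "continuous_on {0..} (\<lambda>s. (s + R) powr e)" using assms by (intro shift_powr_continuous) auto
  show "continuous_on {0..} (\<lambda>s. (s + R) powr (e + 1) / (N + e))" 
    using assms by (intro continuous_on_divide continuous_on_const shift_powr_continuous) auto
qed (use assms in auto)

text \<open>Otherwise the compact set of points in \<open>{0..r}\<close> with nonpositive value has
  a least element, at which \<open>step\<close> is contradicted. At \<open>0\<close> there are no
  earlier points, so \<open>step\<close> must there give positivity outright.\<close>

lemma pos_of_no_first_zero:
  fixes \<phi> :: "real \<Rightarrow> real"
  assumes "continuous_on {0..} \<phi>" "r \<ge> 0"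
    and step: "\<And>r. r \<ge> 0 \<Longrightarrow> (\<And>s. 0 \<le> s \<Longrightarrow> s < r \<Longrightarrow> \<phi> s > 0) \<Longrightarrow> \<phi> r > 0"
  shows "\<phi> r > 0"
proof (rule ccontr)
  assume neg: "\<not> \<phi> r > 0"
  have "closed ({0..r} \<inter> \<phi> -` {..0})"
    by (intro continuous_closed_preimage continuous_on_subset[OF assms(1)]) auto
  then have "compact ({0..r} \<inter> \<phi> -` {..0})"
    by (metis compact_Icc compact_Int_closed inf.left_idem)
  moreover have "{0..r} \<inter> \<phi> -` {..0} \<noteq> {}" using neg assms(2) by force
  ultimately obtain s where s: "s \<in> {0..r} \<inter> \<phi> -` {..0}" "\<And>t. t \<in> {0..r} \<inter> \<phi> -` {..0} \<Longrightarrow> s \<le> t"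
    using compact_attains_inf by metis
  have "\<phi> t > 0" if t: "0 \<le> t" "t < s" for t
  proof (rule ccontr)
    assume "\<not> \<phi> t > 0"
    then have "t \<in> {0..r} \<inter> \<phi> -` {..0}" using t s(1) by auto
    then show False using s(2)[of t] t by linarith
  qed
  moreover have "s \<ge> 0" using s(1) by auto
  ultimately have "\<phi> s > 0" by (rule step[rotated])
  then show False using s(1) by auto
qed

lemma avg_nonneg:
  assumes "N \<ge> 1" "continuous_on {0..} h" "r \<ge> 0" "\<And>s. 0 \<le> s \<Longrightarrow> s \<le> r \<Longrightarrow> 0 \<le> h s"
  shows "avg N h r \<ge> 0"
  using avg_mono[of "\<lambda>_. 0" h r N] avg_const[of N r 0] assms by simp

lemma iterated_avg_mono:
  assumes "N \<ge> 1" "continuous_on {0..} h" "continuous_on {0..} k" "r \<ge> 0" "p > 0" "q > 0"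
    and "\<And>s. 0 \<le> s \<Longrightarrow> 0 \<le> h s" "\<And>s. 0 \<le> s \<Longrightarrow> 0 \<le> k s"
    and "\<And>s. 0 \<le> s \<Longrightarrow> s \<le> r \<Longrightarrow> h s \<le> k s"
  shows "integral {0..r} (avg N (\<lambda>s. avg N (\<lambda>s. h s powr p) s powr q))
    \<le> integral {0..r} (avg N (\<lambda>s. avg N (\<lambda>s. k s powr p) s powr q))"
proof -
  have c1: "continuous_on {0..} (\<lambda>s. l s powr p)" if "continuous_on {0..} l" "\<And>s. 0 \<le> s \<Longrightarrow> 0 \<le> l s" for l :: "real \<Rightarrow> real"
    using that assms(5) by (intro continuous_on_powr_nonneg) auto
  have pos: "avg N (\<lambda>s. l s powr p) s \<ge> 0" if "continuous_on {0..} l" "\<And>s. 0 \<le> s \<Longrightarrow> 0 \<le> l s" "s \<ge> 0" for l s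
    by (rule avg_nonneg[OF assms(1) c1[OF that(1,2)] that(3)]) simp_all
  have c2: "continuous_on {0..} (\<lambda>s. avg N (\<lambda>s. l s powr p) s powr q)" if "continuous_on {0..} l" "\<And>s. 0 \<le> s \<Longrightarrow> 0 \<le> l s" for l
    by (rule continuous_on_powr_nonneg[OF avg_continuous[OF assms(1) c1[OF that]] pos[OF that] assms(6)]) simp_all
  have c3: "avg N (\<lambda>s. avg N (\<lambda>s. l s powr p) s powr q) integrable_on {0..r}" if "continuous_on {0..} l" "\<And>s. 0 \<le> s \<Longrightarrow> 0 \<le> l s" for l
    using avg_continuous[OF assms(1) c2[OF that]] 
    by (intro integrable_continuous_interval) (auto intro: continuous_on_subset)
  have inner: "avg N (\<lambda>s. h s powr p) s \<le> avg N (\<lambda>s. k s powr p) s" if "0 \<le> s" "s \<le> r" for s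
    using that assms(5,7,9) by (intro avg_mono c1 powr_mono2 assms(2,3,7,8)) auto
  have "avg N (\<lambda>s. avg N (\<lambda>s. h s powr p) s powr q) s \<le> avg N (\<lambda>s. avg N (\<lambda>s. k s powr p) s powr q) s" if "0 \<le> s" "s \<le> r" for s
  proof (rule avg_mono[OF c2[OF assms(2,7)] c2[OF assms(3,8)] that(1)])
    fix t assume t: "0 \<le> t" "t \<le> s"
    then show "avg N (\<lambda>s. h s powr p) t powr q \<le> avg N (\<lambda>s. k s powr p) t powr q"
      using that(2) assms(6) by (intro powr_mono2 pos[OF assms(2,7)] inner) simp_all
  qed
  then show ?thesis
    by (intro integral_le c3 assms(2,3,7,8)) auto
qed

text \<open>Matching of exponents and coefficients for \<open>A r^a\<close>: each of the two means
  and the final integration raises the exponent by one. The mean of \<open>s powr e\<close> costs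
  the divisor \<open>N + e\<close>, which gives \<open>N + p * a\<close> and then
  \<open>N + a - 2\<close>, equal to \<open>N + q * (p * a + 1)\<close>; the last integration costs
  \<open>a\<close>.\<close>

locale power_solution =
  fixes N :: nat and p q a A :: real
  assumes N: "N \<ge> 1" and p: "p > 0" and q: "q > 0" and a: "a = q * (p * a + 1) + 2" and A: "A > 0" and a_pos: "a > 0"
    and A_eq: "(A powr p / (N + p * a)) powr q / (N + a - 2) / a = A"
begin

definition "b = A powr p / (N + p * a)"

lemma exponents: "a - 1 = q * (p * a + 1) + 1" "a > 2" "p * a > 0" "q * (p * a + 1) > 0" "b > 0"
proof -
  show "p * a > 0" using p a_pos by simp
  then show "q * (p * a + 1) > 0" using q by simp
  then show "a > 2" using a by linarith
  show "b > 0" using A N \<open>p * a > 0\<close> by (simp add: b_def add_pos_pos)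
qed (use a in linarith)

lemma inner_power:
  assumes "r \<ge> 0"
  shows "avg N (\<lambda>s. (A * s powr a) powr p) r = b * r powr (p * a + 1)"
proof -
  have "avg N (\<lambda>s. (A * s powr a) powr p) r = avg N (\<lambda>s. A powr p * s powr (p * a)) r"
    using A by (intro avg_cong) (auto simp: powr_mult powr_powr mult.commute)
  also have "\<dots> = b * r powr (p * a + 1)"
    using assms exponents N by (simp add: avg_cmult avg_powr b_def)
  finally show ?thesis .
qed

lemma inner_shift:
  assumes "r \<ge> 0" "R > 0"
  shows "avg N (\<lambda>s. (A * (s + R) powr a) powr p) r \<le> b * (r + R) powr (p * a + 1)"
proof -
  have "avg N (\<lambda>s. (A * (s + R) powr a) powr p) r = avg N (\<lambda>s. A powr p * (s + R) powr (p * a)) r"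
    using A assms by (intro avg_cong) (auto simp: powr_mult powr_powr mult.commute)
  also have "\<dots> \<le> A powr p * ((r + R) powr (p * a + 1) / (N + p * a))"
    unfolding avg_cmult using assms exponents N by (intro mult_left_mono avg_shift_powr_le) auto
  finally show ?thesis by (simp add: b_def)
qed

lemma shift_powr_integral:
  fixes r R c e :: real
  assumes "r \<ge> 0" "R \<ge> 0" "e > 0"
  shows "integral {0..r} (\<lambda>s. c * (s + R) powr e) = c * ((r + R) powr (e + 1) - R powr (e + 1)) / (e + 1)"
proof (rule integral_unique)
  have "((\<lambda>s. c * (s + R) powr e) has_integral (c / (e + 1) * (r + R) powr (e + 1) - c / (e + 1) * (0 + R) powr (e + 1))) {0..r}"
  proof (rule fundamental_theorem_of_calculus_interior[OF assms(1)])
    have "continuous_on {0..} (\<lambda>s. c / (e + 1) * (s + R) powr (e + 1))"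
      using assms by (intro continuous_on_mult continuous_on_const shift_powr_continuous) auto
    then show "continuous_on {0..r} (\<lambda>s. c / (e + 1) * (s + R) powr (e + 1))"
      by (rule continuous_on_subset) auto
    fix s assume "s \<in> {0<..<r}"
    then show "((\<lambda>s. c / (e + 1) * (s + R) powr (e + 1)) has_vector_derivative c * (s + R) powr e) (at s)"
      using shift_powr_deriv[of s R "c / (e + 1)" "e + 1"] assms
      by (simp add: has_real_derivative_iff_has_vector_derivative)
  qed
  then show "((\<lambda>s. c * (s + R) powr e) has_integral c * ((r + R) powr (e + 1) - R powr (e + 1)) / (e + 1)) {0..r}"
    by (simp add: right_diff_distrib diff_divide_distrib)
qed

lemma outer_const: "b powr q / (N + q * (p * a + 1)) / a = A"
  using A_eq a unfolding b_def by (smt (verit))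

lemma outer_power:
  assumes "r \<ge> 0"
  shows "integral {0..r} (avg N (\<lambda>s. avg N (\<lambda>s. (A * s powr a) powr p) s powr q)) = A * r powr a"
proof -
  have "avg N (\<lambda>s. avg N (\<lambda>s. (A * s powr a) powr p) s powr q) s 
      = b powr q / (N + q * (p * a + 1)) * (s + 0) powr (a - 1)" if "s \<ge> 0" for s
  proof -
    have "avg N (\<lambda>s. avg N (\<lambda>s. (A * s powr a) powr p) s powr q) s = avg N (\<lambda>s. b powr q * s powr (q * (p * a + 1))) s"
    proof (rule avg_cong)
      fix t :: real assume "0 \<le> t"
      then show "avg N (\<lambda>s. (A * s powr a) powr p) t powr q = b powr q * t powr (q * (p * a + 1))"
        unfolding inner_power[OF \<open>0 \<le> t\<close>] using exponents by (simp add: powr_mult powr_powr mult.commute[of q])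
    qed
    also have "\<dots> = b powr q * s powr (q * (p * a + 1) + 1) / (N + q * (p * a + 1))"
      using that exponents N by (simp add: avg_cmult avg_powr)
    finally show ?thesis unfolding exponents(1) by simp
  qed
  then have "integral {0..r} (avg N (\<lambda>s. avg N (\<lambda>s. (A * s powr a) powr p) s powr q)) 
    = integral {0..r} (\<lambda>s. b powr q / (N + q * (p * a + 1)) * (s + 0) powr (a - 1))"
    by (intro integral_cong) auto
  also have "\<dots> = b powr q / (N + q * (p * a + 1)) / a * r powr a"
    using exponents assms by (subst shift_powr_integral) auto
  finally show ?thesis by (simp only: outer_const)
qed

text \<open>Integrating from \<open>0\<close> produces the loss \<open>A * R powr a\<close>. It is
  what keeps the translate above every solution with smaller initial value.\<close>

lemma outer_shift:
  assumes "r \<ge> 0" "R > 0"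
  shows "integral {0..r} (avg N (\<lambda>s. avg N (\<lambda>s. (A * (s + R) powr a) powr p) s powr q)) 
    \<le> A * (r + R) powr a - A * R powr a"
proof -
  let ?w = "avg N (\<lambda>s. (A * (s + R) powr a) powr p)"
  have cp: "continuous_on {0..} (\<lambda>s. (s + R) powr e)" if "e > 0" for e
    using shift_powr_continuous[of e R] that assms by simp
  have cw: "continuous_on {0..} ?w"
    using A p by (intro avg_continuous N continuous_on_powr_nonneg continuous_on_mult continuous_on_const cp a_pos) auto
  have w0: "?w s \<ge> 0" if "s \<ge> 0" for s
    using A assms(2) p that
    by (intro avg_nonneg N continuous_on_powr_nonneg continuous_on_mult continuous_on_const cp a_pos) auto
  have cwq: "continuous_on {0..} (\<lambda>s. ?w s powr q)"
    using w0 q by (intro continuous_on_powr' cw continuous_intros) auto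
  have le: "avg N (\<lambda>s. ?w s powr q) s \<le> b powr q / (N + q * (p * a + 1)) * (s + R) powr (a - 1)" if "s \<ge> 0" for s
  proof -
    have "avg N (\<lambda>s. ?w s powr q) s \<le> avg N (\<lambda>s. b powr q * (s + R) powr (q * (p * a + 1))) s"
    proof (rule avg_mono[OF cwq _ that])
      show "continuous_on {0..} (\<lambda>s. b powr q * (s + R) powr (q * (p * a + 1)))"
        using exponents by (intro continuous_on_mult continuous_on_const cp)
      fix t assume t: "0 \<le> t" "t \<le> s"
      then have "?w t powr q \<le> (b * (t + R) powr (p * a + 1)) powr q"
        using q assms by (intro powr_mono2 inner_shift w0) auto
      also have "\<dots> = b powr q * (t + R) powr (q * (p * a + 1))"
        using exponents t assms by (simp add: powr_mult powr_powr mult.commute)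
      finally show "?w t powr q \<le> b powr q * (t + R) powr (q * (p * a + 1))" .
    qed
    also have "\<dots> \<le> b powr q * ((s + R) powr (q * (p * a + 1) + 1) / (N + q * (p * a + 1)))"
      unfolding avg_cmult using that exponents N assms by (intro mult_left_mono avg_shift_powr_le) auto
    finally show ?thesis unfolding exponents(1) by simp
  qed
  have "integral {0..r} (avg N (\<lambda>s. ?w s powr q)) \<le> integral {0..r} (\<lambda>s. b powr q / (N + q * (p * a + 1)) * (s + R) powr (a - 1))"
  proof (rule integral_le)
    show "avg N (\<lambda>s. ?w s powr q) integrable_on {0..r}"
      using avg_continuous[OF N cwq] by (intro integrable_continuous_interval) (auto intro: continuous_on_subset)
    have "continuous_on {0..} (\<lambda>s. b powr q / (N + q * (p * a + 1)) * (s + R) powr (a - 1))"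
      using exponents by (intro continuous_on_mult continuous_on_const cp) auto
    then show "(\<lambda>s. b powr q / (N + q * (p * a + 1)) * (s + R) powr (a - 1)) integrable_on {0..r}"
      by (intro integrable_continuous_interval) (auto intro: continuous_on_subset)
  qed (use le in auto)
  also have "\<dots> = b powr q / (N + q * (p * a + 1)) / a * ((r + R) powr a - R powr a)"
    using exponents assms by (subst shift_powr_integral) auto
  finally show ?thesis by (simp only: outer_const right_diff_distrib)
qed

text \<open>\<open>R\<close> is large enough for the translate to start above \<open>V\<close>,
  whereas the pure power starts at \<open>0\<close>, below \<open>V 0\<close>.\<close>

context
  fixes V :: "real \<Rightarrow> real" and R :: real
  assumes cV: "continuous_on {0..} V" and V0: "\<And>r. r \<ge> 0 \<Longrightarrow> V r > 0"
    and eq: "\<And>r. r \<ge> 0 \<Longrightarrow> V r = V 0 + integral {0..r} (avg N (\<lambda>s. avg N (\<lambda>s. V s powr p) s powr q))"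
    and R: "R > 0" "A * R powr a > V 0"
begin

lemma solution_gt_power: 
  assumes "r \<ge> 0"
  shows "A * r powr a < V r"
proof -
  have cS: "continuous_on {0..} (\<lambda>s. A * s powr a)"
    using a_pos by (intro continuous_on_mult continuous_on_const continuous_on_powr' continuous_intros) auto
  have "V r - A * r powr a > 0"
  proof (rule pos_of_no_first_zero[where \<phi> = "\<lambda>r. V r - A * r powr a", OF _ assms])
    show "continuous_on {0..} (\<lambda>r. V r - A * r powr a)" by (intro continuous_on_diff cV cS)
    fix r :: real assume r: "r \<ge> 0" and before: "\<And>s. 0 \<le> s \<Longrightarrow> s < r \<Longrightarrow> 0 < V s - A * s powr a"
    show "0 < V r - A * r powr a"
    proof (cases "r = 0")
      case True then show ?thesis using V0[of 0] by simp
    next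
      case False
      \<comment> \<open>Strict inequality before \<open>r\<close> survives weakly on the closed
        interval, which is all that monotonicity of the operator requires; strictness at
        \<open>r\<close> is regained from \<open>V 0 > 0\<close>.\<close>
      have "V s - A * s powr a \<ge> 0" if "s \<in> closure {0..<r}" for s
      proof (rule continuous_ge_on_closure[OF _ that])
        show "continuous_on (closure {0..<r}) (\<lambda>r. V r - A * r powr a)"
          using False r by (intro continuous_on_diff continuous_on_subset[OF cV] continuous_on_subset[OF cS]) auto
      qed (use before in force)
      then have "A * s powr a \<le> V s" if "0 \<le> s" "s \<le> r" for s
        using that False by simp
      then have "integral {0..r} (avg N (\<lambda>s. avg N (\<lambda>s. (A * s powr a) powr p) s powr q)) 
        \<le> integral {0..r} (avg N (\<lambda>s. avg N (\<lambda>s. V s powr p) s powr q))"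
        using V0 A p q by (intro iterated_avg_mono N cS cV r) (auto intro: less_imp_le)
      then show ?thesis using eq[OF r] V0[of 0] by (simp add: outer_power r)
    qed
  qed
  then show ?thesis by simp
qed

lemma solution_lt_shift: 
  assumes "r \<ge> 0"
  shows "V r < A * (r + R) powr a"
proof -
  have cS: "continuous_on {0..} (\<lambda>s. A * (s + R) powr a)"
    using a_pos R by (intro continuous_on_mult continuous_on_const shift_powr_continuous) auto
  have "A * (r + R) powr a - V r > 0"
  proof (rule pos_of_no_first_zero[where \<phi> = "\<lambda>r. A * (r + R) powr a - V r", OF _ assms])
    show "continuous_on {0..} (\<lambda>r. A * (r + R) powr a - V r)" by (intro continuous_on_diff cV cS)
    fix r :: real assume r: "r \<ge> 0" and before: "\<And>s. 0 \<le> s \<Longrightarrow> s < r \<Longrightarrow> 0 < A * (s + R) powr a - V s"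
    show "0 < A * (r + R) powr a - V r"
    proof (cases "r = 0")
      case True then show ?thesis using R by simp
    next
      case False
      have "A * (s + R) powr a - V s \<ge> 0" if "s \<in> closure {0..<r}" for s
      proof (rule continuous_ge_on_closure[OF _ that])
        show "continuous_on (closure {0..<r}) (\<lambda>r. A * (r + R) powr a - V r)"
          using False r by (intro continuous_on_diff continuous_on_subset[OF cV] continuous_on_subset[OF cS]) auto
      qed (use before in force)
      then have "V s \<le> A * (s + R) powr a" if "0 \<le> s" "s \<le> r" for s
        using that False by simp
      then have "integral {0..r} (avg N (\<lambda>s. avg N (\<lambda>s. V s powr p) s powr q))
        \<le> integral {0..r} (avg N (\<lambda>s. avg N (\<lambda>s. (A * (s + R) powr a) powr p) s powr q))"
        using V0 A p q by (intro iterated_avg_mono N cS cV r) (auto intro: less_imp_le)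
      \<comment> \<open>The equation adds \<open>V 0\<close>, the supersolution estimate subtracts
        the larger \<open>A * R powr a\<close>.\<close>
      then show ?thesis using eq[OF r] R outer_shift[OF r R(1)] by linarith
    qed
  qed
  then show ?thesis by simp
qed

lemma solution_inner_bounds:
  assumes "r \<ge> 0"
  shows "b * r powr (p * a + 1) \<le> avg N (\<lambda>s. V s powr p) r"
    and "avg N (\<lambda>s. V s powr p) r \<le> b * (r + R) powr (p * a + 1)"
proof -
  have cVp: "continuous_on {0..} (\<lambda>s. V s powr p)"
    using V0 p by (intro continuous_on_powr' cV continuous_intros) (auto simp: less_le)
  have cS: "continuous_on {0..} (\<lambda>s. A * (s + Q) powr a)" if "Q \<ge> 0" for Q
    using that a_pos by (intro continuous_on_mult continuous_on_const shift_powr_continuous) auto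
  have "avg N (\<lambda>s. (A * s powr a) powr p) r \<le> avg N (\<lambda>s. V s powr p) r"
    using A p a_pos solution_gt_power assms
    by (intro avg_mono cVp powr_mono2 continuous_on_powr_nonneg cS[of 0, simplified]) (auto intro: less_imp_le)
  then show "b * r powr (p * a + 1) \<le> avg N (\<lambda>s. V s powr p) r" using assms by (simp add: inner_power)
  have "avg N (\<lambda>s. V s powr p) r \<le> avg N (\<lambda>s. (A * (s + R) powr a) powr p) r"
    using A p a_pos solution_lt_shift assms R V0
    by (intro avg_mono cVp powr_mono2 continuous_on_powr_nonneg cS[of R]) (auto intro: less_imp_le)
  then show "avg N (\<lambda>s. V s powr p) r \<le> b * (r + R) powr (p * a + 1)" 
    using inner_shift[OF assms R(1)] by linarith
qed

text \<open>Integrating the bounds on \<open>u'\<close> traps \<open>u - u(0)\<close>. The loss at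
  the lower endpoint is dropped, since only the leading order matters.\<close>

lemma solution_integral_bounds:
  assumes "r \<ge> 0"
  shows "b / (p * a + 2) * r powr (p * a + 2) \<le> integral {0..r} (avg N (\<lambda>s. V s powr p))"
    and "integral {0..r} (avg N (\<lambda>s. V s powr p)) \<le> b / (p * a + 2) * (r + R) powr (p * a + 2)"
proof -
  have cVp: "continuous_on {0..} (\<lambda>s. V s powr p)"
    using V0 p by (intro continuous_on_powr' cV continuous_intros) (auto simp: less_le)
  have i1: "avg N (\<lambda>s. V s powr p) integrable_on {0..r}"
    using avg_continuous[OF N cVp] by (intro integrable_continuous_interval) (auto intro: continuous_on_subset)
  have i2: "(\<lambda>s. b * (s + Q) powr (p * a + 1)) integrable_on {0..r}" if "Q \<ge> 0" for Q
  proof -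
    have "continuous_on {0..} (\<lambda>s. b * (s + Q) powr (p * a + 1))"
      using exponents that by (intro continuous_on_mult continuous_on_const shift_powr_continuous) auto
    then show ?thesis by (intro integrable_continuous_interval) (auto intro: continuous_on_subset)
  qed
  have "integral {0..r} (\<lambda>s. b * (s + 0) powr (p * a + 1)) \<le> integral {0..r} (avg N (\<lambda>s. V s powr p))"
    using solution_inner_bounds by (intro integral_le i1 i2) auto
  then show "b / (p * a + 2) * r powr (p * a + 2) \<le> integral {0..r} (avg N (\<lambda>s. V s powr p))"
    using exponents assms by (subst (asm) shift_powr_integral) (auto simp: add.assoc)
  have "integral {0..r} (avg N (\<lambda>s. V s powr p)) \<le> integral {0..r} (\<lambda>s. b * (s + R) powr (p * a + 1))"
    using solution_inner_bounds R by (intro integral_le i1 i2) auto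
  also have "\<dots> = b / (p * a + 2) * (r + R) powr (p * a + 2) - b / (p * a + 2) * R powr (p * a + 2)"
    using exponents assms R by (subst shift_powr_integral) (auto simp: add.assoc right_diff_distrib diff_divide_distrib)
  also have "\<dots> \<le> b / (p * a + 2) * (r + R) powr (p * a + 2)"
    using exponents by simp
  finally show "integral {0..r} (avg N (\<lambda>s. V s powr p)) \<le> b / (p * a + 2) * (r + R) powr (p * a + 2)" .
qed

end

end

text \<open>The shift disappears because \<open>(1 + R / r) powr e\<close> tends to
  \<open>1\<close>. The constant \<open>d\<close> makes room for the initial value
  \<open>u(0)\<close>.\<close>

lemma tendsto_of_shift_bounds:
  fixes Y :: "real \<Rightarrow> real"
  assumes "R \<ge> 0" "e > 0" 
    and "\<And>r. r \<ge> 0 \<Longrightarrow> c * r powr e \<le> Y r" "\<And>r. r \<ge> 0 \<Longrightarrow> Y r \<le> c * (r + R) powr e"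
  shows "((\<lambda>r. (d + Y r) / r powr e) \<longlongrightarrow> c) at_top"
proof -
  have d: "((\<lambda>r. d / r powr e) \<longlongrightarrow> 0) at_top"
  proof -
    have "((\<lambda>r::real. r powr - e) \<longlongrightarrow> 0) at_top"
      using assms(2) by (intro tendsto_neg_powr filterlim_ident) auto
    from tendsto_mult_right_zero[OF this, of d] show ?thesis by (simp add: powr_minus_divide)
  qed
  have "((\<lambda>r. c * (1 + R / r) powr e) \<longlongrightarrow> c * (1 + 0) powr e) at_top"
    by (intro tendsto_intros real_tendsto_divide_at_top filterlim_ident) auto
  then have u: "((\<lambda>r. c * (1 + R / r) powr e) \<longlongrightarrow> c) at_top" by simp
  have "((\<lambda>r. Y r / r powr e) \<longlongrightarrow> c) at_top"
  proof (rule tendsto_sandwich[OF _ _ tendsto_const u])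
    show "\<forall>\<^sub>F r in at_top. c \<le> Y r / r powr e"
      using eventually_gt_at_top[of 0] by eventually_elim (use assms(3) in \<open>simp add: field_simps\<close>)
    show "\<forall>\<^sub>F r in at_top. Y r / r powr e \<le> c * (1 + R / r) powr e"
      using eventually_gt_at_top[of 0]
    proof eventually_elim
      case (elim r)
      then have "(1 + R / r) powr e = (r + R) powr e / r powr e"
        using assms(1) by (subst powr_divide[symmetric]) (auto simp: field_simps)
      then show ?case using assms(4)[of r] elim by (simp add: divide_right_mono)
    qed
  qed
  from tendsto_add[OF d this] show ?thesis by (simp add: add_divide_distrib)
qed

section \<open>The Keller--Osserman estimates\<close>

text \<open>For nondecreasing \<open>h\<close> the mean is at most \<open>h r * r / N\<close>, so
  the singular term consumes at most the fraction \<open>(N - 1) / N\<close> of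
  \<open>h r\<close>.\<close>

lemma avg_deriv_bounds:
  assumes "N \<ge> 1" "continuous_on {0..} h" "mono_on {0..} h" "h 0 \<ge> 0" "r > 0"
  shows "h r / N \<le> h r - (real N - 1) * avg N h r / r" and "h r - (real N - 1) * avg N h r / r \<le> h r"
proof -
  have le: "avg N h r \<le> avg N (\<lambda>_. h r) r"
    using assms by (intro avg_mono) (auto intro: mono_onD)
  have "(real N - 1) * (avg N h r / r) \<le> (real N - 1) * (h r / N)"
    using le assms by (intro mult_left_mono) (auto simp: avg_const field_simps)
  also have "\<dots> = h r - h r / N" using assms by (simp add: field_simps)
  finally show "h r / N \<le> h r - (real N - 1) * avg N h r / r" by simp
  have "h s \<ge> 0" if "s \<ge> 0" for s using mono_onD[OF assms(3), of 0 s] that assms by simp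
  then have "avg N h r \<ge> 0" using assms by (intro avg_nonneg) auto
  then show "h r - (real N - 1) * avg N h r / r \<le> h r" using assms by simp
qed

text \<open>Carries monotonicity from \<open>v\<close> to \<open>w\<close> and thus to
  \<open>f(w)\<close>, so that the derivative bounds can be used for both means.\<close>

lemma avg_mono_on:
  assumes "N \<ge> 1" "continuous_on {0..} h" "mono_on {0..} h" "h 0 \<ge> 0"
  shows "mono_on {0..} (avg N h)"
proof (rule mono_onI)
  fix a b :: real assume ab: "a \<in> {0..}" "b \<in> {0..}" "a \<le> b"
  show "avg N h a \<le> avg N h b"
  proof (rule DERIV_nonneg_imp_increasing_open[OF ab(3)])
    fix x assume x: "a < x" "x < b"
    then have x0: "x > 0" using ab by simp
    have "h x \<ge> 0" using mono_onD[OF assms(3), of 0 x] x0 assms by simp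
    then have "0 \<le> h x / N" by simp
    with avg_deriv[OF assms(1,2) x0] avg_deriv_bounds(1)[OF assms x0]
    show "\<exists>y. (avg N h has_real_derivative y) (at x) \<and> 0 \<le> y" by (meson order_trans)
  qed (use ab in \<open>auto intro!: continuous_on_subset[OF avg_continuous[OF assms(1,2)]]\<close>)
qed

text \<open>Dominated convergence. Continuity is asked of the \<open>hs n\<close> alone: when this
  is applied, the limit profile is not yet known to be continuous.\<close>

lemma avg_tendsto:
  fixes hs :: "nat \<Rightarrow> real \<Rightarrow> real"
  assumes "\<And>n. continuous_on {0..} (hs n)" "r \<ge> 0"
    and "\<And>n s. 0 \<le> s \<Longrightarrow> s \<le> r \<Longrightarrow> \<bar>hs n s\<bar> \<le> M"
    and "\<And>s. 0 \<le> s \<Longrightarrow> s \<le> r \<Longrightarrow> (\<lambda>n. hs n s) \<longlonglongrightarrow> h s"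
  shows "(\<lambda>n. avg N (hs n) r) \<longlonglongrightarrow> avg N h r"
proof (cases "r = 0")
  case False
  have "(\<lambda>n. integral {0..r} (\<lambda>s. s^(N-1) * hs n s)) \<longlonglongrightarrow> integral {0..r} (\<lambda>s. s^(N-1) * h s)"
  proof (rule dominated_convergence(2))
    show "(\<lambda>s. s^(N-1) * M) integrable_on {0..r}" by (rule weighted_integrable) simp
    show "(\<lambda>n. s^(N-1) * hs n s) \<longlonglongrightarrow> s^(N-1) * h s" if "s \<in> {0..r}" for s
      using that by (intro tendsto_intros assms) auto
    show "norm (s^(N-1) * hs n s) \<le> s^(N-1) * M" if "s \<in> {0..r}" for n s
      using that assms(3)[of s n] by (auto simp: abs_mult intro!: mult_left_mono)
  qed (intro weighted_integrable assms)
  then show ?thesis using False unfolding avg_def by (intro tendsto_divide tendsto_const) auto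
qed simp

locale keller_osserman =
  fixes p :: real and f :: "real \<Rightarrow> real" and N :: nat
  assumes p: "p > 0" and N: "N \<ge> 1" and cf: "continuous_on {0..} f" and mf: "mono_on {0..} f" and fpos: "\<And>t. t > 0 \<Longrightarrow> f t > 0"
begin

section \<open>Double primitive of the nonlinearity and the divergence integral\<close>

definition "F s = integral {0..s} f"
definition "G s = integral {0..s} F"
definition "gap s = G s powr (- p / (2 * p + 1))"
text \<open>Acts as a clock: where \<open>w'\<close> is comparable to
  \<open>G(w)^(p/(2p+1))\<close>, the derivative of \<open>\<Phi> (w r)\<close> is comparable to
  \<open>1\<close>. The lower limit \<open>1\<close> stays away from the zero of
  \<open>G\<close>.\<close>

definition "\<Phi> T = integral {1..T} gap"
definition "slope V = avg N (\<lambda>s. V s powr p)"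

lemma f_nonneg: "t \<ge> 0 \<Longrightarrow> f t \<ge> 0"
proof (cases "t = 0")
  case True
  have "(f \<longlongrightarrow> f 0) (at_right 0)"
    using cf unfolding continuous_on_def by (metis at_within_Ici_at_right atLeast_iff order_refl)
  moreover have "eventually (\<lambda>t. 0 \<le> f t) (at_right 0)"
    using fpos by (auto simp: eventually_at_filter intro!: always_eventually less_imp_le)
  ultimately have "f 0 \<ge> 0" by (intro tendsto_lowerbound) auto
  then show ?thesis using True by simp
qed (use fpos in \<open>auto intro: less_imp_le\<close>)

lemma integrable_of_cont: "continuous_on {a..} (h :: real \<Rightarrow> real) \<Longrightarrow> h integrable_on {a..r}"
  by (intro integrable_continuous_interval) (auto intro: continuous_on_subset)

lemma F_props: "F 0 = 0" "continuous_on {0..} F" "s > 0 \<Longrightarrow> (F has_real_derivative f s) (at s)"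
  unfolding F_def[abs_def]
  by (auto intro!: integral_continuous integrable_of_cont cf integral_deriv_interior)

lemma G_props: "G 0 = 0" "continuous_on {0..} G" "s > 0 \<Longrightarrow> (G has_real_derivative F s) (at s)"
  unfolding G_def[abs_def]
  by (auto intro!: integral_continuous integrable_of_cont F_props integral_deriv_interior)

lemma F_pos: "s > 0 \<Longrightarrow> F s > 0"
  using DERIV_pos_imp_increasing_open[of 0 s F] F_props fpos
  by (metis atLeastatMost_subset_iff continuous_on_subset atLeastAtMost_iff atLeast_iff subsetI)

lemma G_less: "0 \<le> s \<Longrightarrow> s < t \<Longrightarrow> G s < G t"
proof (rule DERIV_pos_imp_increasing_open[of s t G])
  assume "0 \<le> s" "s < t"
  then show "continuous_on {s..t} G" by (intro continuous_on_subset[OF G_props(2)]) auto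
  fix x assume "s < x" "x < t"
  then show "\<exists>y. (G has_real_derivative y) (at x) \<and> 0 < y"
    using G_props(3)[of x] F_pos[of x] \<open>0 \<le> s\<close> by auto
qed

lemma G_pos: "s > 0 \<Longrightarrow> G s > 0"
  using G_less[of 0 s] G_props by simp

lemma G_le: "0 \<le> s \<Longrightarrow> s \<le> t \<Longrightarrow> G s \<le> G t"
  using G_less[of s t] by (cases "s = t") auto

lemma gap_continuous: "continuous_on {1..} gap"
proof -
  have "G x \<noteq> 0" if "x \<in> {1..}" for x using G_pos[of x] that by auto
  then show ?thesis
    unfolding gap_def[abs_def]
    by (intro continuous_on_powr continuous_on_const continuous_on_subset[OF G_props(2)]) auto
qed

lemma Phi_props: "\<Phi> 1 = 0" "continuous_on {1..} \<Phi>" "s > 1 \<Longrightarrow> (\<Phi> has_real_derivative gap s) (at s)"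
  unfolding \<Phi>_def[abs_def]
  by (auto intro!: integral_continuous integrable_of_cont gap_continuous integral_deriv_interior)

lemma Phi_le: "1 \<le> s \<Longrightarrow> s \<le> t \<Longrightarrow> \<Phi> s \<le> \<Phi> t"
proof (rule DERIV_nonneg_imp_increasing_open[of s t \<Phi>])
  assume "1 \<le> s" "s \<le> t"
  then show "continuous_on {s..t} \<Phi>" by (intro continuous_on_subset[OF Phi_props(2)]) auto
  fix x assume "s < x" "x < t"
  then show "\<exists>y. (\<Phi> has_real_derivative y) (at x) \<and> 0 \<le> y"
    using Phi_props(3)[of x] \<open>1 \<le> s\<close> by (auto simp: gap_def)
qed

text \<open>\<phi> is the Laplacian belonging to \<open>V\<close> and is not identified with
  \<open>f (w s)\<close>. For a Picard iterate it is the forcing of the previous iterate, which lies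
  below \<open>f (w s)\<close>; for a solution the two agree. Upper estimates assume \<phi> below
  \<open>f (w s)\<close>, lower estimates assume it above.\<close>

context
  fixes V \<phi> :: "real \<Rightarrow> real"
  assumes c\<phi>: "continuous_on {0..} \<phi>" and m\<phi>: "mono_on {0..} \<phi>" and \<phi>0: "\<phi> 0 \<ge> 0"
    and V0: "V 0 > 0" and V_eq: "\<And>r. r \<ge> 0 \<Longrightarrow> V r = V 0 + integral {0..r} (avg N \<phi>)"
begin

definition "Z = avg N \<phi>"
abbreviation "w \<equiv> slope V"

lemma \<phi>_nonneg: "s \<ge> 0 \<Longrightarrow> \<phi> s \<ge> 0"
  using mono_onD[OF m\<phi>, of 0 s] \<phi>0 by simp

lemma cZ: "continuous_on {0..} Z"
  unfolding Z_def by (intro avg_continuous N c\<phi>)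

lemma Z_nonneg: "r \<ge> 0 \<Longrightarrow> Z r \<ge> 0"
  unfolding Z_def by (intro avg_nonneg N c\<phi> \<phi>_nonneg)

lemma V_eq': "r \<ge> 0 \<Longrightarrow> V 0 + integral {0..r} Z = V r"
  unfolding Z_def by (rule V_eq[symmetric])

lemma cV: "continuous_on {0..} V"
proof -
  have "continuous_on {0..} (\<lambda>r. V 0 + integral {0..r} Z)"
    by (intro continuous_on_add continuous_on_const integral_continuous integrable_of_cont cZ)
  then show ?thesis
    by (rule continuous_on_eq) (simp add: V_eq')
qed

lemma V_deriv: "r > 0 \<Longrightarrow> (V has_real_derivative Z r) (at r)"
proof -
  assume r: "r > 0"
  have "((\<lambda>r. V 0 + integral {0..r} Z) has_real_derivative Z r) (at r)"
    using integral_deriv_interior[OF cZ r] by (auto intro!: derivative_eq_intros)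
  then show ?thesis
    by (rule has_field_derivative_transform_within[OF _ r]) (auto simp: V_eq' dist_real_def)
qed

lemma mV: "mono_on {0..} V"
proof (rule mono_onI)
  fix a b :: real assume ab: "a \<in> {0..}" "b \<in> {0..}" "a \<le> b"
  show "V a \<le> V b"
  proof (rule DERIV_nonneg_imp_increasing_open[OF ab(3)])
    fix x assume "a < x" "x < b"
    then show "\<exists>y. (V has_real_derivative y) (at x) \<and> 0 \<le> y"
      using V_deriv[of x] Z_nonneg[of x] ab by auto
  qed (use ab in \<open>auto intro!: continuous_on_subset[OF cV]\<close>)
qed

lemma V_ge: "r \<ge> 0 \<Longrightarrow> V 0 \<le> V r"
  using mono_onD[OF mV, of 0 r] by simp

lemma V_pos: "r \<ge> 0 \<Longrightarrow> V r > 0"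
  using V_ge[of r] V0 by simp

lemma cVp: "continuous_on {0..} (\<lambda>s. V s powr p)"
  using V_pos p by (intro continuous_on_powr_nonneg cV) (auto simp: less_imp_le)

lemma mVp: "mono_on {0..} (\<lambda>s. V s powr p)"
  using mV V_pos p by (intro mono_onI powr_mono2) (auto simp: mono_on_def less_imp_le)

lemma cw: "continuous_on {0..} w"
  unfolding slope_def by (intro avg_continuous N cVp)

lemma mw: "mono_on {0..} w"
  unfolding slope_def by (intro avg_mono_on N cVp mVp) simp

lemma w_0: "w 0 = 0" by (simp add: slope_def)

lemma w_ge: "r \<ge> 0 \<Longrightarrow> V 0 powr p * r / N \<le> w r"
  unfolding slope_def avg_const[OF N, symmetric]
  using V_ge V0 p by (intro avg_mono cVp powr_mono2) auto

lemma w_nonneg: "r \<ge> 0 \<Longrightarrow> w r \<ge> 0"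
  unfolding slope_def by (intro avg_nonneg N cVp) auto

lemma w_pos: "r > 0 \<Longrightarrow> w r > 0"
  using w_ge[of r] V0 N by (smt (verit) divide_pos_pos mult_pos_pos of_nat_0_less_iff powr_gt_zero less_le_trans zero_less_one)

definition "dw r = V r powr p - (real N - 1) * w r / r"
definition "dZ r = \<phi> r - (real N - 1) * Z r / r"

lemma w_deriv: "r > 0 \<Longrightarrow> (w has_real_derivative dw r) (at r)"
  unfolding slope_def dw_def using avg_deriv[OF N cVp] by simp

lemma dw_bounds: "r > 0 \<Longrightarrow> V r powr p \<le> N * dw r" "r > 0 \<Longrightarrow> dw r \<le> V r powr p" "r > 0 \<Longrightarrow> 0 \<le> dw r"
proof -
  assume r: "r > 0"
  show 1: "V r powr p \<le> N * dw r" 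
    using avg_deriv_bounds(1)[OF N cVp mVp _ r] N unfolding slope_def dw_def by (simp add: field_simps)
  show "dw r \<le> V r powr p" 
    using avg_deriv_bounds(2)[OF N cVp mVp _ r] unfolding slope_def dw_def by simp
  have "0 \<le> N * dw r" using 1 powr_ge_zero order_trans by blast
  then show "0 \<le> dw r" using N by (simp add: zero_le_mult_iff)
qed

lemma Z_deriv: "r > 0 \<Longrightarrow> (Z has_real_derivative dZ r) (at r)"
  unfolding Z_def dZ_def using avg_deriv[OF N c\<phi>] by simp

lemma dZ_bounds: "r > 0 \<Longrightarrow> \<phi> r \<le> N * dZ r" "r > 0 \<Longrightarrow> dZ r \<le> \<phi> r"
  using avg_deriv_bounds[OF N c\<phi> m\<phi> \<phi>0, of r] N unfolding Z_def dZ_def by (auto simp: field_simps)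

text \<open>This controls the term $p V^{p-1} V'^2$ in the derivative of $V^p V'$.\<close>

lemma Z_sq: 
  assumes "r > 0"
  shows "Z r ^ 2 \<le> 2 * \<phi> r * V r"
proof -
  \<comment> \<open>Freezing the source at its largest value \<open>\<phi> r\<close> gives a
    comparison function whose derivative involves only \<open>Z\<close>.\<close>
  have "Z r ^ 2 - Z 0 ^ 2 \<le> 2 * \<phi> r * V r - 2 * \<phi> r * V 0"
  proof (rule increment_le_of_deriv_le[where \<phi> = "\<lambda>s. Z s ^ 2" and \<psi> = "\<lambda>s. 2 * \<phi> r * V s"])
    show "continuous_on {0..r} (\<lambda>s. Z s ^ 2)" "continuous_on {0..r} (\<lambda>s. 2 * \<phi> r * V s)"
      by (intro continuous_intros continuous_on_subset[OF cZ] continuous_on_subset[OF cV]; auto)+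
    fix s assume s: "0 < s" "s < r"
    show "((\<lambda>s. Z s ^ 2) has_real_derivative 2 * Z s * dZ s) (at s)"
      using Z_deriv[OF s(1)] by (auto intro!: derivative_eq_intros)
    show "((\<lambda>s. 2 * \<phi> r * V s) has_real_derivative 2 * \<phi> r * Z s) (at s)"
      using V_deriv[OF s(1)] by (auto intro!: derivative_eq_intros)
    have "dZ s \<le> \<phi> r" using dZ_bounds(2)[OF s(1)] mono_onD[OF m\<phi>, of s r] s by simp
    from mult_left_mono[OF this, of "2 * Z s"] Z_nonneg[of s] s
    show "2 * Z s * dZ s \<le> 2 * \<phi> r * Z s" by (simp add: mult.commute mult.left_commute)
  qed (use assms in auto)
  moreover have "2 * \<phi> r * V 0 \<ge> 0" using \<phi>_nonneg V0 assms by simp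
  moreover have "Z 0 ^ 2 = 0" by (simp add: Z_def)
  ultimately show ?thesis by linarith
qed

text \<open>The derivative of \<open>V^(p+1) / (p+1)\<close>, an energy comparable with
  \<open>F (w r)\<close>.\<close>

definition "H r = V r powr p * Z r"
definition "dH r = V r powr p * dZ r + p * V r powr (p - 1) * Z r ^ 2"

lemma H_deriv: "r > 0 \<Longrightarrow> (H has_real_derivative dH r) (at r)"
proof -
  assume r: "r > 0"
  have "((\<lambda>r. V r powr p) has_real_derivative p * V r powr (p - 1) * Z r) (at r)"
    using DERIV_fun_powr[OF V_deriv[OF r] V_pos, of p] r by simp
  from DERIV_mult[OF this Z_deriv[OF r]] show ?thesis
    unfolding H_def[abs_def] dH_def by (simp add: power2_eq_square mult_ac add.commute)
qed

lemma cH: "continuous_on {0..} H"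
  unfolding H_def[abs_def] by (intro continuous_on_mult cVp cZ)

lemma H_0: "H 0 = 0" by (simp add: H_def Z_def)

lemma H_nonneg: "r \<ge> 0 \<Longrightarrow> H r \<ge> 0"
  unfolding H_def using Z_nonneg by simp

lemma cont_comp_w: "continuous_on {0..} h \<Longrightarrow> continuous_on {0..r} (\<lambda>s. h (w s))"
  by (rule continuous_on_compose2[of "{0..}"]) (auto intro!: continuous_on_subset[OF cw] w_nonneg)

lemma Fw_deriv: "r > 0 \<Longrightarrow> ((\<lambda>r. F (w r)) has_real_derivative f (w r) * dw r) (at r)"
  using DERIV_chain2[OF F_props(3) w_deriv, of r] w_pos by simp

lemma Gw_deriv: "r > 0 \<Longrightarrow> ((\<lambda>r. G (w r)) has_real_derivative F (w r) * dw r) (at r)"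
  using DERIV_chain2[OF G_props(3) w_deriv, of r] w_pos by simp

lemma V_power_deriv: "r > 0 \<Longrightarrow> ((\<lambda>r. V r powr (2 * p + 1)) has_real_derivative (2 * p + 1) * V r powr p * H r) (at r)"
  using DERIV_fun_powr[OF V_deriv V_pos, of r "2 * p + 1"] powr_add[of "V r" p p]
  by (simp add: H_def mult_ac)

lemma cV_power: "continuous_on {0..r} (\<lambda>r. V r powr (2 * p + 1))"
  using V_pos p by (intro continuous_on_powr_nonneg continuous_on_subset[OF cV]) (auto simp: less_imp_le)

text \<open>Two integrations: \<open>H'\<close> is bounded by a multiple of \<open>f(w) w'\<close>,
  hence \<open>H\<close> by one of \<open>F(w)\<close>; multiplying by \<open>V^p <= N w'\<close>
  then bounds the derivative of \<open>V^(2p+1)\<close>. Each round costs a factor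
  \<open>(2 p + 1) N\<close>, hence the square.\<close>

lemma V_power_le:
  assumes "\<And>s. s \<ge> 0 \<Longrightarrow> \<phi> s \<le> f (w s)" "r \<ge> 0"
  shows "V r powr (2 * p + 1) \<le> V 0 powr (2 * p + 1) + ((2 * p + 1) * N)\<^sup>2 * G (w r)"
proof -
  have H_le: "H r \<le> (2 * p + 1) * N * F (w r)" if r: "r \<ge> 0" for r
  proof -
    have "H r - H 0 \<le> (2 * p + 1) * N * F (w r) - (2 * p + 1) * N * F (w 0)"
    proof (rule increment_le_of_deriv_le[OF r, where \<phi> = H and \<psi> = "\<lambda>r. (2 * p + 1) * N * F (w r)"])
      show "continuous_on {0..r} H" by (intro continuous_on_subset[OF cH]) auto
      show "continuous_on {0..r} (\<lambda>r. (2 * p + 1) * N * F (w r))" 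
        by (intro continuous_on_mult continuous_on_const cont_comp_w F_props)
      fix s assume s: "0 < s" "s < r"
      show "(H has_real_derivative dH s) (at s)" by (rule H_deriv[OF s(1)])
      show "((\<lambda>r. (2 * p + 1) * N * F (w r)) has_real_derivative (2 * p + 1) * N * (f (w s) * dw s)) (at s)"
        by (rule DERIV_cmult[OF Fw_deriv[OF s(1)]])
      have Vs: "V s > 0" using V_pos s by simp
      \<comment> \<open>\<open>Z_sq\<close> turns the second summand into \<open>2 p\<close> copies
        of the first, whence the factor \<open>2 p + 1\<close>.\<close>
      have "dH s \<le> V s powr p * \<phi> s + p * V s powr (p - 1) * (2 * \<phi> s * V s)"
        unfolding dH_def using s dZ_bounds(2)[OF s(1)] Z_sq[OF s(1)] p
        by (intro add_mono mult_left_mono) auto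
      also have "\<dots> = (2 * p + 1) * (\<phi> s * V s powr p)"
        using Vs powr_add[of "V s" "p - 1" 1] by (simp add: algebra_simps)
      also have "\<dots> \<le> (2 * p + 1) * (f (w s) * (N * dw s))"
        using p s dw_bounds(1)[OF s(1)] assms(1)[of s] \<phi>_nonneg[of s]
        by (intro mult_left_mono mult_mono) auto
      finally show "dH s \<le> (2 * p + 1) * N * (f (w s) * dw s)" by (simp add: mult_ac)
    qed
    then show ?thesis by (simp add: H_0 w_0 F_props)
  qed
  have "V r powr (2 * p + 1) - V 0 powr (2 * p + 1) \<le> ((2 * p + 1) * N)\<^sup>2 * G (w r) - ((2 * p + 1) * N)\<^sup>2 * G (w 0)"
  proof (rule increment_le_of_deriv_le[OF assms(2), where \<phi> = "\<lambda>r. V r powr (2 * p + 1)" and \<psi> = "\<lambda>r. ((2 * p + 1) * N)\<^sup>2 * G (w r)"])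
    show "continuous_on {0..r} (\<lambda>r. ((2 * p + 1) * N)\<^sup>2 * G (w r))" 
      by (intro continuous_on_mult continuous_on_const cont_comp_w G_props)
    fix s assume s: "0 < s" "s < r"
    show "((\<lambda>r. V r powr (2 * p + 1)) has_real_derivative (2 * p + 1) * V s powr p * H s) (at s)"
      by (rule V_power_deriv[OF s(1)])
    show "((\<lambda>r. ((2 * p + 1) * N)\<^sup>2 * G (w r)) has_real_derivative ((2 * p + 1) * N)\<^sup>2 * (F (w s) * dw s)) (at s)"
      by (rule DERIV_cmult[OF Gw_deriv[OF s(1)]])
    have "(2 * p + 1) * V s powr p * H s \<le> (2 * p + 1) * (N * dw s) * ((2 * p + 1) * N * F (w s))"
      using s p dw_bounds[OF s(1)] H_le[of s] H_nonneg[of s] by (intro mult_mono) auto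
    then show "(2 * p + 1) * V s powr p * H s \<le> ((2 * p + 1) * N)\<^sup>2 * (F (w s) * dw s)"
      by (simp add: power2_eq_square mult_ac)
  qed (rule cV_power)
  then show ?thesis by (simp add: w_0 G_props)
qed

lemma G_w_le:
  assumes "\<And>s. s \<ge> 0 \<Longrightarrow> f (w s) \<le> \<phi> s" "r \<ge> 0"
  shows "G (w r) \<le> N / (2 * p + 1) * V r powr (2 * p + 1)"
proof -
  have F_le: "F (w r) \<le> N * H r" if r: "r \<ge> 0" for r
  proof -
    have "F (w r) - F (w 0) \<le> N * H r - N * H 0"
    proof (rule increment_le_of_deriv_le[OF r, where \<phi> = "\<lambda>r. F (w r)" and \<psi> = "\<lambda>r. N * H r"])
      show "continuous_on {0..r} (\<lambda>r. N * H r)" 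
        by (intro continuous_on_mult continuous_on_const continuous_on_subset[OF cH]) auto
      show "continuous_on {0..r} (\<lambda>r. F (w r))" by (intro cont_comp_w F_props)
      fix s assume s: "0 < s" "s < r"
      show "((\<lambda>r. F (w r)) has_real_derivative f (w s) * dw s) (at s)" by (rule Fw_deriv[OF s(1)])
      show "((\<lambda>r. N * H r) has_real_derivative N * dH s) (at s)" by (rule DERIV_cmult[OF H_deriv[OF s(1)]])
      have "f (w s) * dw s \<le> (N * dZ s) * V s powr p"
        using s dw_bounds[OF s(1)] dZ_bounds(1)[OF s(1)] assms(1)[of s] \<phi>_nonneg[of s]
        by (intro mult_mono) auto
      also have "\<dots> \<le> N * dH s"
        unfolding dH_def using p by (simp add: distrib_left mult_ac)
      finally show "f (w s) * dw s \<le> N * dH s" .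
    qed
    then show ?thesis by (simp add: H_0 w_0 F_props)
  qed
  have "G (w r) - G (w 0) \<le> N / (2 * p + 1) * V r powr (2 * p + 1) - N / (2 * p + 1) * V 0 powr (2 * p + 1)"
  proof (rule increment_le_of_deriv_le[OF assms(2), where \<phi> = "\<lambda>r. G (w r)" and \<psi> = "\<lambda>r. N / (2 * p + 1) * V r powr (2 * p + 1)"])
    show "continuous_on {0..r} (\<lambda>r. G (w r))" by (intro cont_comp_w G_props)
    fix s assume s: "0 < s" "s < r"
    show "((\<lambda>r. N / (2 * p + 1) * V r powr (2 * p + 1)) has_real_derivative N / (2 * p + 1) * ((2 * p + 1) * V s powr p * H s)) (at s)"
      by (rule DERIV_cmult[OF V_power_deriv[OF s(1)]])
    show "((\<lambda>r. G (w r)) has_real_derivative F (w s) * dw s) (at s)"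
      by (rule Gw_deriv[OF s(1)])
    have "F (w s) * dw s \<le> (N * H s) * V s powr p"
      using s dw_bounds[OF s(1)] F_le[of s] H_nonneg[of s] by (intro mult_mono) auto
    then show "F (w s) * dw s \<le> N / (2 * p + 1) * ((2 * p + 1) * V s powr p * H s)"
      using p by (simp add: mult_ac)
  qed (intro continuous_on_mult continuous_on_const cV_power)
  moreover have "0 \<le> N / (2 * p + 1) * V 0 powr (2 * p + 1)" using p by simp
  ultimately show ?thesis by (simp add: w_0 G_props)
qed

text \<open>\<open>V_power_le\<close> raised to the power \<open>p / (2 p + 1)\<close> bounds
  \<open>w'\<close> by a multiple of \<open>G(w + 1)^(p/(2p+1))\<close>, so the clock runs at
  bounded rate. The shift by one makes it start at the base point of \<Phi>, because
  \<open>w 0 = 0\<close>.\<close>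

lemma Phi_w_le:
  assumes "\<And>s. s \<ge> 0 \<Longrightarrow> \<phi> s \<le> f (w s)" "r \<ge> 0" "V 0 = 1"
  shows "\<Phi> (w r + 1) \<le> (1 / G 1 + ((2 * p + 1) * N)\<^sup>2) powr (p / (2 * p + 1)) * r"
proof -
  define C where "C = (1 / G 1 + ((2 * p + 1) * N)\<^sup>2)"
  have C: "C > 0" using G_pos[of 1] unfolding C_def by (intro add_pos_nonneg) auto
  have "\<Phi> (w r + 1) - \<Phi> (w 0 + 1) \<le> C powr (p / (2 * p + 1)) * r - C powr (p / (2 * p + 1)) * 0"
  proof (rule increment_le_of_deriv_le[OF assms(2), where \<phi> = "\<lambda>r. \<Phi> (w r + 1)" and \<psi> = "\<lambda>r. C powr (p / (2 * p + 1)) * r"])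
    show "continuous_on {0..r} (\<lambda>r. \<Phi> (w r + 1))"
      by (rule cont_comp_w[of "\<lambda>t. \<Phi> (t + 1)"], rule continuous_on_compose2[OF Phi_props(2)])
         (auto intro: continuous_intros)
    show "continuous_on {0..r} (\<lambda>r. C powr (p / (2 * p + 1)) * r)" by (intro continuous_intros)
    fix s assume s: "0 < s" "s < r"
    have ws: "w s > 0" using w_pos s by simp
    have "((\<lambda>r. w r + 1) has_real_derivative dw s) (at s)"
      using w_deriv[OF s(1)] by (auto intro!: derivative_eq_intros)
    from DERIV_chain2[OF Phi_props(3) this] ws
    show "((\<lambda>r. \<Phi> (w r + 1)) has_real_derivative gap (w s + 1) * dw s) (at s)" by simp
    show "((\<lambda>r. C powr (p / (2 * p + 1)) * r) has_real_derivative C powr (p / (2 * p + 1))) (at s)"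
      by (auto intro!: derivative_eq_intros)
    have G1: "G (w s + 1) > 0" using ws G_pos by simp
    have "V s powr (2 * p + 1) \<le> 1 + ((2 * p + 1) * N)\<^sup>2 * G (w s)"
      using V_power_le[of s] assms s by simp
    \<comment> \<open>The shift also absorbs the initial value, through
      \<open>1 <= G (w s + 1) / G 1\<close>; this is the origin of \<open>1 / G 1\<close> in the
      constant.\<close>
    also have "\<dots> \<le> G (w s + 1) / G 1 + ((2 * p + 1) * N)\<^sup>2 * G (w s + 1)"
      using G_le[of 1 "w s + 1"] G_le[of "w s" "w s + 1"] ws G_pos[of 1]
      by (intro add_mono mult_left_mono) auto
    also have "\<dots> = C * G (w s + 1)" by (simp add: C_def distrib_right)
    finally have "(V s powr (2 * p + 1)) powr (p / (2 * p + 1)) \<le> (C * G (w s + 1)) powr (p / (2 * p + 1))"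
      using p by (intro powr_mono2) auto
    then have "V s powr p \<le> C powr (p / (2 * p + 1)) * G (w s + 1) powr (p / (2 * p + 1))"
      using p C G1 by (simp add: powr_powr powr_mult)
    then have "dw s \<le> C powr (p / (2 * p + 1)) * G (w s + 1) powr (p / (2 * p + 1))"
      using dw_bounds(2)[OF s(1)] by simp
    then have "gap (w s + 1) * dw s \<le> gap (w s + 1) * (C powr (p / (2 * p + 1)) * G (w s + 1) powr (p / (2 * p + 1)))"
      by (intro mult_left_mono) (auto simp: gap_def)
    also have "\<dots> = C powr (p / (2 * p + 1)) * (G (w s + 1) powr (p / (2 * p + 1)) * G (w s + 1) powr (- p / (2 * p + 1)))"
      by (simp add: gap_def)
    also have "\<dots> = C powr (p / (2 * p + 1))"
      using G1 by (simp add: powr_add[symmetric])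
    finally show "gap (w s + 1) * dw s \<le> C powr (p / (2 * p + 1))" .
  qed
  then show ?thesis by (simp add: w_0 Phi_props C_def)
qed

text \<open>By \<open>G_w_le\<close>, \<open>V^p\<close> is at least a multiple of
  \<open>G(w)^(p/(2p+1))\<close>, and \<open>w' >= V^p / N\<close>. Hence the clock advances at
  least linearly, and the half line of radii is unbounded.\<close>

lemma Phi_diverges:
  assumes "\<And>s. s \<ge> 0 \<Longrightarrow> f (w s) \<le> \<phi> s"
  shows "filterlim \<Phi> at_top at_top"
proof -
  define \<alpha> where "\<alpha> = p / (2 * p + 1)"
  define c where "c = (1 / N) * (N / (2 * p + 1)) powr - \<alpha>"
  \<comment> \<open>The linear lower bound \<open>w_ge\<close> equals \<open>2\<close> at
    \<open>r0\<close>; from there on \<open>w\<close> exceeds \<open>1\<close>, where \<Phi> is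
    differentiable.\<close>
  define r0 where "r0 = N * 2 / V 0 powr p"
  have c: "c > 0" using N p by (auto simp: c_def)
  have r0: "r0 > 0" using V0 N by (auto simp: r0_def)
  have w1: "w s > 1" if "s \<ge> r0" for s
  proof -
    have "V 0 powr p * r0 / N = 2" using V0 N by (simp add: r0_def)
    then have "w r0 > 1" using w_ge[of r0] r0 by simp
    then show ?thesis using mono_onD[OF mw, of r0 s] that r0 by simp
  qed
  have grow: "c * r - c * r0 \<le> \<Phi> (w r) - \<Phi> (w r0)" if r: "r0 \<le> r" for r
  proof (rule increment_le_of_deriv_le[OF r, where \<phi> = "\<lambda>r. c * r" and \<psi> = "\<lambda>r. \<Phi> (w r)"])
    show "continuous_on {r0..r} (\<lambda>r. \<Phi> (w r))"
      by (rule continuous_on_compose2[OF Phi_props(2) continuous_on_subset[OF cw]])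
         (use r0 w1 in \<open>auto intro: less_imp_le\<close>)
    show "continuous_on {r0..r} (\<lambda>r. c * r)" by (intro continuous_intros)
    fix s assume s: "r0 < s" "s < r"
    have s0: "s > 0" using s r0 by simp
    have ws: "w s > 1" using w1 s by simp
    show "((\<lambda>r. c * r) has_real_derivative c) (at s)" by (auto intro!: derivative_eq_intros)
    show "((\<lambda>r. \<Phi> (w r)) has_real_derivative gap (w s) * dw s) (at s)"
      by (rule DERIV_chain2[OF Phi_props(3)[OF ws] w_deriv[OF s0]])
    have Gs: "G (w s) > 0" using ws G_pos by simp
    have Vs: "V s > 0" using V_pos s0 by simp
    have "(N / (2 * p + 1) * V s powr (2 * p + 1)) powr - \<alpha> \<le> G (w s) powr - \<alpha>"
      using G_w_le[OF assms, of s] Gs s0 p by (intro powr_mono2') (auto simp: \<alpha>_def)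
    moreover have "(N / (2 * p + 1) * V s powr (2 * p + 1)) powr - \<alpha> = (N / (2 * p + 1)) powr - \<alpha> * V s powr - p"
      using Vs p N by (subst powr_mult) (auto simp: powr_powr \<alpha>_def)
    ultimately have gs: "(N / (2 * p + 1)) powr - \<alpha> * V s powr - p \<le> gap (w s)"
      by (simp add: gap_def \<alpha>_def)
    have "c = ((N / (2 * p + 1)) powr - \<alpha> * V s powr - p) * (V s powr p / N)"
      using Vs by (simp add: c_def powr_minus field_simps)
    also have "\<dots> \<le> gap (w s) * dw s"
      using gs dw_bounds(1)[OF s0] N by (intro mult_mono) (auto simp: field_simps gap_def)
    finally show "c \<le> gap (w s) * dw s" .
  qed
  show ?thesis
    unfolding filterlim_at_top
  proof
    fix K :: real
    \<comment> \<open>At this radius the linear lower bound reaches \<open>|K|\<close>; beyond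
      \<open>w r\<close> monotonicity of \<Phi> suffices.\<close>
    define r where "r = r0 + \<bar>K\<bar> / c"
    have r: "r \<ge> r0" using c by (simp add: r_def)
    have "c * r - c * r0 = \<bar>K\<bar>" using c by (simp add: r_def field_simps)
    then have "\<bar>K\<bar> \<le> \<Phi> (w r) - \<Phi> (w r0)" using grow[OF r] by simp
    moreover have "\<Phi> (w r0) \<ge> 0" using Phi_le[of 1 "w r0"] w1[of r0] Phi_props by simp
    ultimately have K: "K \<le> \<Phi> (w r)" by linarith
    show "eventually (\<lambda>T. K \<le> \<Phi> T) at_top"
      using eventually_ge_at_top[of "w r"]
      by eventually_elim (use K Phi_le w1[OF r] in \<open>smt (verit)\<close>)
  qed
qed

end

end

section \<open>Existence of global solutions\<close>

context keller_osserman
begin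

text \<open>The class to which the derivative bounds apply; it is stable under \<open>step\<close>,
  and monotonicity with \<open>V 0 > 0\<close> makes its members positive on the half line.\<close>

definition admissible :: "(real \<Rightarrow> real) \<Rightarrow> bool" where
  "admissible V \<longleftrightarrow> continuous_on {0..} V \<and> mono_on {0..} V \<and> V 0 > 0"

definition "forcing V s = f (slope V s)"

definition "step V r = 1 + integral {0..r} (avg N (forcing V))"

lemma admissible_powr:
  assumes "admissible V"
  shows "continuous_on {0..} (\<lambda>s. V s powr p)" "mono_on {0..} (\<lambda>s. V s powr p)"
proof -
  have V: "V s > 0" if "s \<ge> 0" for s
    using assms mono_onD[of "{0..}" V 0 s] that by (simp add: admissible_def)
  show "continuous_on {0..} (\<lambda>s. V s powr p)"
    using assms V p by (intro continuous_on_powr_nonneg) (auto simp: admissible_def less_imp_le)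
  show "mono_on {0..} (\<lambda>s. V s powr p)"
    using assms V p by (auto simp: admissible_def mono_on_def less_imp_le intro!: powr_mono2)
qed

lemma admissible_w:
  assumes "admissible V"
  shows "continuous_on {0..} (slope V)" "mono_on {0..} (slope V)" "s \<ge> 0 \<Longrightarrow> slope V s \<ge> 0"
  unfolding slope_def using admissible_powr[OF assms]
  by (auto intro!: avg_continuous avg_mono_on avg_nonneg N)

lemma admissible_forcing:
  assumes "admissible V"
  shows "continuous_on {0..} (forcing V)" "mono_on {0..} (forcing V)" "forcing V 0 \<ge> 0" "s \<ge> 0 \<Longrightarrow> forcing V s \<ge> 0"
proof -
  note w = admissible_w[OF assms]
  show "continuous_on {0..} (forcing V)"
    unfolding forcing_def[abs_def] by (rule continuous_on_compose2[OF cf w(1)]) (use w(3) in auto)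
  show "mono_on {0..} (forcing V)"
    unfolding forcing_def using w by (intro mono_onI mono_onD[OF mf] mono_onD[OF w(2)]) auto
  show "forcing V 0 \<ge> 0" "s \<ge> 0 \<Longrightarrow> forcing V s \<ge> 0"
    unfolding forcing_def using w f_nonneg by auto
qed

lemma step_0: "step V 0 = 1"
  by (simp add: step_def)

lemma admissible_step:
  assumes "admissible V"
  shows "admissible (step V)"
proof -
  note F = admissible_forcing[OF assms]
  have eq: "step V r = step V 0 + integral {0..r} (avg N (forcing V))" for r
    by (simp add: step_def)
  have "step V 0 > 0" by (simp add: step_0)
  then show ?thesis
    unfolding admissible_def using cV[OF F(1-3) _ eq] mV[OF F(1-3) _ eq] by simp
qed

lemma w_le:
  assumes "admissible V" "admissible V'" "r \<ge> 0" "\<And>s. 0 \<le> s \<Longrightarrow> V s \<le> V' s"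
  shows "slope V r \<le> slope V' r"
proof -
  have "V s \<ge> 0" if "s \<ge> 0" for s
    using assms(1) mono_onD[of "{0..}" V 0 s] that by (simp add: admissible_def)
  then show ?thesis
    unfolding slope_def using assms p by (intro avg_mono admissible_powr powr_mono2) auto
qed

lemma forcing_le:
  assumes "admissible V" "admissible V'" "r \<ge> 0" "\<And>s. 0 \<le> s \<Longrightarrow> V s \<le> V' s"
  shows "forcing V r \<le> forcing V' r"
  unfolding forcing_def using assms admissible_w w_le[OF assms] by (intro mono_onD[OF mf]) auto

lemma step_le:
  assumes "admissible V" "admissible V'" "r \<ge> 0" "\<And>s. 0 \<le> s \<Longrightarrow> V s \<le> V' s"
  shows "step V r \<le> step V' r"
  unfolding step_def using assms
  by (intro add_left_mono integral_le integrable_of_cont avg_continuous avg_mono N admissible_forcing forcing_le) auto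

definition "picard n = (step ^^ n) (\<lambda>_. 1)"

lemma picard_Suc: "picard (Suc n) = step (picard n)"
  by (simp add: picard_def)

lemma admissible_picard: "admissible (picard n)"
  by (induction n) (auto simp: picard_Suc admissible_step, simp add: picard_def admissible_def mono_on_def)

lemma picard_0: "picard n 0 = 1"
  by (cases n) (auto simp: picard_Suc step_0, simp add: picard_def)

lemma picard_ge: "r \<ge> 0 \<Longrightarrow> picard n r \<ge> 1"
  using admissible_picard[of n] mono_onD[of "{0..}" "picard n" 0 r] by (simp add: admissible_def picard_0)

text \<open>The first iterate is the constant \<open>1\<close>, a lower bound for all iterates, and
  \<open>step\<close> preserves order.\<close>

lemma picard_mono: "r \<ge> 0 \<Longrightarrow> picard n r \<le> picard (Suc n) r"
proof (induction n arbitrary: r)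
  case 0
  then show ?case using picard_ge[of r "Suc 0"] by (simp add: picard_def)
next
  case (Suc n)
  then show ?case unfolding picard_Suc[of "Suc n"] picard_Suc[of n]
    using step_le[OF admissible_picard admissible_picard Suc.prems, of n "Suc n"] by (simp add: picard_Suc)
qed

text \<open>The source of iterate \<open>Suc n\<close> is \<open>forcing (picard n)\<close>, which
  lies below its own forcing because the iterates increase; so the one-sided estimates apply, with
  constants free of \<open>n\<close>.\<close>

lemma picard_Suc_bounds:
  assumes "r \<ge> 0"
  shows "\<Phi> (slope (picard (Suc n)) r + 1) \<le> (1 / G 1 + ((2 * p + 1) * N)\<^sup>2) powr (p / (2 * p + 1)) * r"
    and "picard (Suc n) r powr (2 * p + 1) \<le> 1 + ((2 * p + 1) * N)\<^sup>2 * G (slope (picard (Suc n)) r)"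
proof -
  note F = admissible_forcing[OF admissible_picard[of n]]
  have eq: "picard (Suc n) r = picard (Suc n) 0 + integral {0..r} (avg N (forcing (picard n)))" for r
    by (simp add: picard_Suc step_def)
  have V0: "picard (Suc n) 0 > 0" by (simp add: picard_0)
  have le: "forcing (picard n) s \<le> f (slope (picard (Suc n)) s)" if "s \<ge> 0" for s
    unfolding forcing_def[symmetric] by (intro forcing_le admissible_picard that picard_mono)
  show "\<Phi> (slope (picard (Suc n)) r + 1) \<le> (1 / G 1 + ((2 * p + 1) * N)\<^sup>2) powr (p / (2 * p + 1)) * r"
    by (rule Phi_w_le[OF F(1-3) V0 eq le assms picard_0])
  show "picard (Suc n) r powr (2 * p + 1) \<le> 1 + ((2 * p + 1) * N)\<^sup>2 * G (slope (picard (Suc n)) r)"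
    using V_power_le[OF F(1-3) V0 eq le assms] by (simp add: picard_0)
qed

lemma picard_bounded:
  assumes div: "filterlim \<Phi> at_top at_top"
  obtains B where "\<And>n r. 0 \<le> r \<Longrightarrow> r \<le> R \<Longrightarrow> slope (picard n) r \<le> B" "\<And>n r. 0 \<le> r \<Longrightarrow> r \<le> R \<Longrightarrow> picard n r \<le> B"
proof -
  define C where "C = (1 / G 1 + ((2 * p + 1) * N)\<^sup>2) powr (p / (2 * p + 1))"
  define D where "D = ((2 * p + 1) * N)\<^sup>2"
  have "eventually (\<lambda>T. C * R + 1 \<le> \<Phi> T) at_top" using div by (auto simp: filterlim_at_top)
  \<comment> \<open>Beyond \<open>B0\<close> the clock exceeds \<open>C * R\<close>, a value it
    cannot pass at radii up to \<open>R\<close>.\<close>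
  then obtain B0 where B0: "\<And>T. T \<ge> B0 \<Longrightarrow> C * R + 1 \<le> \<Phi> T" by (auto simp: eventually_at_top_linorder)
  define B where "B = max B0 0"
  have wS: "slope (picard (Suc n)) r \<le> B" if r: "0 \<le> r" "r \<le> R" for n r
  proof (rule ccontr)
    assume "\<not> slope (picard (Suc n)) r \<le> B"
    then have "C * R + 1 \<le> \<Phi> (slope (picard (Suc n)) r + 1)" by (intro B0) (simp add: B_def)
    also have "\<dots> \<le> C * r" unfolding C_def by (rule picard_Suc_bounds[OF r(1)])
    also have "\<dots> \<le> C * R" using r by (intro mult_left_mono) (auto simp: C_def)
    finally show False by simp
  qed
  \<comment> \<open>The estimates cover successors only, so an arbitrary iterate is compared with
    its successor.\<close>
  have w: "slope (picard n) r \<le> B" if r: "0 \<le> r" "r \<le> R" for n r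
    using w_le[OF admissible_picard admissible_picard r(1) picard_mono, of n] wS[OF r, of n] by linarith
  have V: "picard n r \<le> 1 + D * G B" if r: "0 \<le> r" "r \<le> R" for n r
  proof -
    have "picard n r \<le> picard (Suc n) r" using picard_mono r by simp
    also have "\<dots> \<le> picard (Suc n) r powr (2 * p + 1)"
      using powr_mono[of 1 "2 * p + 1" "picard (Suc n) r"] picard_ge[OF r(1), of "Suc n"] p by simp
    also have "\<dots> \<le> 1 + D * G (slope (picard (Suc n)) r)"
      unfolding D_def by (rule picard_Suc_bounds[OF r(1)])
    also have "\<dots> \<le> 1 + D * G B"
      using wS[OF r] admissible_w(3)[OF admissible_picard r(1)]
      by (intro add_left_mono mult_left_mono G_le) (auto simp: D_def)
    finally show ?thesis .
  qed
  show thesis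
  proof (rule that[of "max B (1 + D * G B)"])
    show "slope (picard n) r \<le> max B (1 + D * G B)" if "0 \<le> r" "r \<le> R" for n r using w[OF that, of n] by simp
    show "picard n r \<le> max B (1 + D * G B)" if "0 \<le> r" "r \<le> R" for n r using V[OF that, of n] by simp
  qed
qed

text \<open>Increasing and locally bounded iterates converge pointwise, and dominated convergence
  passes to the limit in both means and in the outer integral. Continuity of the limit does not come
  from pointwise convergence; it is read off afterwards from the integral equation.\<close>

lemma global_solution:
  assumes div: "filterlim \<Phi> at_top at_top"
  obtains V where "continuous_on {0..} V" "\<And>r. r \<ge> 0 \<Longrightarrow> V r \<ge> 1"
    "continuous_on {0..} (forcing V)" "\<And>r. r \<ge> 0 \<Longrightarrow> slope V r \<ge> 0"
    "\<And>r. r \<ge> 0 \<Longrightarrow> V r = 1 + integral {0..r} (avg N (forcing V))"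
proof -
  define V where "V r = lim (\<lambda>n. picard n r)" for r
  have incV: "incseq (\<lambda>n. picard n r)" if "r \<ge> 0" for r
    using picard_mono that by (intro incseq_SucI) auto
  have limV: "(\<lambda>n. picard n r) \<longlonglongrightarrow> V r" if r: "r \<ge> 0" for r
  proof -
    obtain B where B: "\<And>n s. 0 \<le> s \<Longrightarrow> s \<le> r \<Longrightarrow> picard n s \<le> B" using picard_bounded[OF div] by metis
    have "\<forall>n. picard n r \<le> B" using B[of r] r by simp
    with incV[OF r] obtain L where "(\<lambda>n. picard n r) \<longlonglongrightarrow> L" by (rule incseq_convergent)
    then show ?thesis unfolding V_def by (simp add: limI)
  qed
  have V1: "V r \<ge> 1" if "r \<ge> 0" for r
    by (rule LIMSEQ_le_const[OF limV[OF that]]) (use picard_ge[OF that] in auto)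
  have limw: "(\<lambda>n. slope (picard n) r) \<longlonglongrightarrow> slope V r" if r: "r \<ge> 0" for r
  proof -
    obtain B where B: "\<And>n s. 0 \<le> s \<Longrightarrow> s \<le> r \<Longrightarrow> picard n s \<le> B" using picard_bounded[OF div] by metis
    show ?thesis unfolding slope_def
    proof (rule avg_tendsto[OF admissible_powr(1)[OF admissible_picard] r, where M = "B powr p"])
      fix s assume s: "0 \<le> s" "s \<le> r"
      show "\<bar>picard n s powr p\<bar> \<le> B powr p" for n
        using B[OF s, of n] picard_ge[OF s(1), of n] p by (auto intro!: powr_mono2)
      show "(\<lambda>n. picard n s powr p) \<longlonglongrightarrow> V s powr p"
        using V1[OF s(1)] by (intro tendsto_powr limV s tendsto_const) auto
    qed
  qed
  have w0: "slope V r \<ge> 0" if "r \<ge> 0" for r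
    by (rule LIMSEQ_le_const[OF limw[OF that]]) (use admissible_w(3)[OF admissible_picard that] in auto)
  have limf: "(\<lambda>n. forcing (picard n) r) \<longlonglongrightarrow> forcing V r" if r: "r \<ge> 0" for r
    unfolding forcing_def
    by (rule continuous_on_tendsto_compose[OF cf limw[OF r]]) (use w0 admissible_w(3)[OF admissible_picard] r in auto)
  have bound: "\<exists>M. \<forall>n s. 0 \<le> s \<and> s \<le> r \<longrightarrow> 0 \<le> forcing (picard n) s \<and> forcing (picard n) s \<le> M" for r
  proof -
    obtain B where B: "\<And>n s. 0 \<le> s \<Longrightarrow> s \<le> r \<Longrightarrow> slope (picard n) s \<le> B" using picard_bounded[OF div] by metis
    have "0 \<le> forcing (picard n) s \<and> forcing (picard n) s \<le> f B" if s: "0 \<le> s" "s \<le> r" for n s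
      using B[OF s, of n] admissible_w(3)[OF admissible_picard s(1), of n] admissible_forcing(4)[OF admissible_picard s(1), of n]
      unfolding forcing_def by (auto intro!: mono_onD[OF mf])
    then show ?thesis by blast
  qed
  have limZ: "(\<lambda>n. avg N (forcing (picard n)) r) \<longlonglongrightarrow> avg N (forcing V) r" if r: "r \<ge> 0" for r
  proof -
    obtain M where M: "\<And>n s. 0 \<le> s \<and> s \<le> r \<Longrightarrow> 0 \<le> forcing (picard n) s \<and> forcing (picard n) s \<le> M" using bound by blast
    show ?thesis
      by (rule avg_tendsto[OF admissible_forcing(1)[OF admissible_picard] r, where M = M])
         (use M limf in auto)
  qed
  \<comment> \<open>Dominated convergence also yields integrability of the limit, whose continuity
    is still unknown here. The majorant \<open>M * s / N\<close> is the mean of the constant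
    \<open>M\<close>.\<close>
  have J: "avg N (forcing V) integrable_on {0..r} \<and> 
      (\<lambda>n. integral {0..r} (avg N (forcing (picard n)))) \<longlonglongrightarrow> integral {0..r} (avg N (forcing V))" for r
  proof -
    obtain M where M: "\<And>n s. 0 \<le> s \<and> s \<le> r \<Longrightarrow> 0 \<le> forcing (picard n) s \<and> forcing (picard n) s \<le> M" using bound by blast
    have le: "norm (avg N (forcing (picard n)) s) \<le> M * s / N" if s: "s \<in> {0..r}" for n s
    proof -
      have "avg N (forcing (picard n)) s \<le> avg N (\<lambda>_. M) s"
        using s M by (intro avg_mono admissible_forcing admissible_picard continuous_on_const) auto
      moreover have "avg N (forcing (picard n)) s \<ge> 0"
        using s by (intro avg_nonneg N admissible_forcing admissible_picard) auto
      ultimately show ?thesis using s N by (simp add: avg_const)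
    qed
    have i: "avg N (forcing (picard n)) integrable_on {0..r}" for n
      by (intro integrable_of_cont avg_continuous N admissible_forcing admissible_picard)
    have iM: "(\<lambda>s. M * s / N) integrable_on {0..r}"
      using N by (intro integrable_of_cont continuous_intros) auto
    have lim: "(\<lambda>n. avg N (forcing (picard n)) s) \<longlonglongrightarrow> avg N (forcing V) s" if "s \<in> {0..r}" for s
      using limZ that by simp
    show ?thesis using dominated_convergence[OF i iM le lim] by blast
  qed
  have eq: "V r = 1 + integral {0..r} (avg N (forcing V))" if r: "r \<ge> 0" for r
  proof (rule LIMSEQ_unique)
    show "(\<lambda>n. picard (Suc n) r) \<longlonglongrightarrow> V r" using limV[OF r] by (rule LIMSEQ_Suc)
    show "(\<lambda>n. picard (Suc n) r) \<longlonglongrightarrow> 1 + integral {0..r} (avg N (forcing V))"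
      unfolding picard_Suc step_def using J by (intro tendsto_intros) auto
  qed
  have "continuous_on {0..} (\<lambda>r. 1 + integral {0..r} (avg N (forcing V)))"
    using J by (intro continuous_on_add continuous_on_const integral_continuous) auto
  then have cV: "continuous_on {0..} V" by (rule continuous_on_eq) (simp add: eq)
  have cw: "continuous_on {0..} (slope V)"
    unfolding slope_def
    by (intro avg_continuous N continuous_on_powr_nonneg cV p) (use V1 in force)
  have "continuous_on {0..} (forcing V)"
    unfolding forcing_def[abs_def] by (rule continuous_on_compose2[OF cf cw]) (use w0 in auto)
  with that cV V1 w0 eq show thesis by blast
qed

end

section \<open>From the system to radial integral equations; the existence criterion\<close>

lemma pos_rad_sol_ode:
  fixes u v :: "real^'n \<Rightarrow> real" and k :: 'n
  assumes sol: "pos_rad_sol p f u v" and p: "p > 0"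
  defines "N \<equiv> CARD('n)" and "V \<equiv> \<lambda>r. v (r *\<^sub>R axis k 1)"
  shows "continuous_on {0..} V" "V r > 0" "v x = V (norm x)"
    "u x = u 0 + integral {0..norm x} (avg N (\<lambda>s. V s powr p))"
    "r \<ge> 0 \<Longrightarrow> V r = V 0 + integral {0..r} (avg N (\<lambda>s. f (avg N (\<lambda>s. V s powr p) s)))"
    "continuous_on {0..} (\<lambda>s. f (avg N (\<lambda>s. V s powr p) s))"
proof -
  have u: "C2 u" "radial u" and v: "C2 v" "radial v" and pos: "\<And>x. v x > 0"
    and lu: "\<And>x. laplacian u x = v x powr p" and lv: "\<And>x. laplacian v x = f (norm (grad u x))"
    using sol by (auto simp: pos_rad_sol_def)
  have N: "N \<ge> 1" by (simp add: N_def Suc_leI)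
  have "continuous_on UNIV v"
    using v(1) by (auto simp: C2_def continuous_on_eq_continuous_at differentiable_imp_continuous_within)
  then show cV: "continuous_on {0..} V"
    unfolding V_def by (rule continuous_on_compose2) (auto intro!: continuous_intros)
  show Vpos: "V r > 0" for r by (simp add: V_def pos)
  have Ku: "(\<lambda>r. laplacian u (r *\<^sub>R axis k 1)) = (\<lambda>s. V s powr p)" by (simp add: lu V_def)
  note ru = radial_ode[OF u, where k = k, unfolded Ku, folded N_def]
  note rv = radial_ode[OF v, where k = k, folded N_def]
  have w0: "avg N (\<lambda>s. V s powr p) s \<ge> 0" if "s \<ge> 0" for s
    using that by (intro avg_nonneg N ru) auto
  \<comment> \<open>The mean of \<open>V powr p\<close> is nonnegative, so the absolute value in the
    gradient formula disappears.\<close>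
  have Kv: "laplacian v (s *\<^sub>R axis k 1) = f (avg N (\<lambda>s. V s powr p) s)" if "s \<ge> 0" for s
    using w0[OF that] that by (simp add: lv ru(3))
  show vV: "v x = V (norm x)" for x
  proof -
    have "norm x = norm (norm x *\<^sub>R axis k 1 :: real^'n)" by simp
    then show ?thesis using v(2) unfolding V_def radial_def by blast
  qed
  show "u x = u 0 + integral {0..norm x} (avg N (\<lambda>s. V s powr p))" by (rule ru(2))
  \<comment> \<open>Continuity is inherited from the Laplacian of the C2 function \<open>v\<close>,
    with which the source agrees on the ray.\<close>
  show "continuous_on {0..} (\<lambda>s. f (avg N (\<lambda>s. V s powr p) s))"
    by (rule continuous_on_eq[OF rv(1)]) (simp add: Kv)
  show "V r = V 0 + integral {0..r} (avg N (\<lambda>s. f (avg N (\<lambda>s. V s powr p) s)))" if r: "r \<ge> 0" for r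
  proof -
    have "V r = V 0 + integral {0..r} (avg N (\<lambda>r. laplacian v (r *\<^sub>R axis k 1)))"
      using rv(2)[of "r *\<^sub>R axis k 1"] r by (simp add: V_def)
    also have "integral {0..r} (avg N (\<lambda>r. laplacian v (r *\<^sub>R axis k 1))) = integral {0..r} (avg N (\<lambda>s. f (avg N (\<lambda>s. V s powr p) s)))"
      using Kv by (intro integral_cong avg_cong) auto
    finally show ?thesis .
  qed
qed

lemma ex_pos_rad_sol_iff:
  fixes p :: real and f :: "real \<Rightarrow> real"
  assumes p0: "p > 0" and cf: "continuous_on {0..} f"
    and fmono: "mono_on {0..} f" and fpos: "\<And>t. t > 0 \<Longrightarrow> f t > 0"
  shows "(\<exists>u v :: real^'n \<Rightarrow> real. pos_rad_sol p f u v) \<longleftrightarrow>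
           filterlim (\<lambda>T. integral {1..T}
              (\<lambda>s. (integral {0..s} (\<lambda>t. integral {0..t} f)) powr (-p/(2*p+1)))) at_top at_top"
proof -
  interpret keller_osserman p f "CARD('n)"
    by unfold_locales (use assms in \<open>auto simp: Suc_leI\<close>)
  have "\<Phi> = (\<lambda>T. integral {1..T} (\<lambda>s. (integral {0..s} (\<lambda>t. integral {0..t} f)) powr (-p/(2*p+1))))"
    by (simp add: \<Phi>_def[abs_def] gap_def[abs_def] G_def[abs_def] F_def[abs_def])
  moreover have "(\<exists>u v :: real^'n \<Rightarrow> real. pos_rad_sol p f u v) \<longleftrightarrow> filterlim \<Phi> at_top at_top"
  proof
    assume "\<exists>u v :: real^'n \<Rightarrow> real. pos_rad_sol p f u v"
    then obtain u v :: "real^'n \<Rightarrow> real" where sol: "pos_rad_sol p f u v" by blast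
    define V where "V r = v (r *\<^sub>R axis undefined 1)" for r
    note ode = pos_rad_sol_ode[OF sol p0, where k = undefined, folded V_def, folded slope_def, folded forcing_def]
    have w0: "slope V s \<ge> 0" if "s \<ge> 0" for s
      unfolding slope_def using that p0 ode(2)
      by (intro avg_nonneg N continuous_on_powr_nonneg ode(1)) (auto simp: less_imp_le)
    \<comment> \<open>Monotonicity is not part of being a solution; it follows because
      \<open>V'\<close> is the mean of a nonnegative forcing.\<close>
    have "mono_on {0..} V"
    proof (rule mono_onI)
      fix a b :: real assume ab: "a \<in> {0..}" "b \<in> {0..}" "a \<le> b"
      have "0 \<le> avg CARD('n) (forcing V) s" if "s \<ge> 0" for s
      proof (rule avg_nonneg[OF N ode(6) that])
        show "0 \<le> forcing V t" if "0 \<le> t" for t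
          using w0[OF that] f_nonneg by (simp add: forcing_def)
      qed
      then have "integral {0..a} (avg CARD('n) (forcing V)) \<le> integral {0..b} (avg CARD('n) (forcing V))"
        using ab by (intro integral_subset_le integrable_of_cont avg_continuous[OF N ode(6)]) auto
      moreover have "V a = V 0 + integral {0..a} (avg CARD('n) (forcing V))" "V b = V 0 + integral {0..b} (avg CARD('n) (forcing V))"
        using ab by (auto intro!: ode(5))
      ultimately show "V a \<le> V b" by linarith
    qed
    then have adm: "admissible V" using ode(1,2) by (simp add: admissible_def)
    show "filterlim \<Phi> at_top at_top"
      by (rule Phi_diverges[OF admissible_forcing(1-3)[OF adm] ode(2) ode(5)]) (simp_all add: forcing_def)
  next
    assume "filterlim \<Phi> at_top at_top"
    then obtain V where cV: "continuous_on {0..} V" and V1: "\<And>r. r \<ge> 0 \<Longrightarrow> V r \<ge> 1"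
      and cF: "continuous_on {0..} (forcing V)" and w0: "\<And>r. r \<ge> 0 \<Longrightarrow> slope V r \<ge> 0"
      and eq: "\<And>r. r \<ge> 0 \<Longrightarrow> V r = 1 + integral {0..r} (avg CARD('n) (forcing V))"
      by (rule global_solution) blast
    have cVp: "continuous_on {0..} (\<lambda>s. V s powr p)"
      by (intro continuous_on_powr_nonneg cV p0) (use V1 in force)
    \<comment> \<open>The system sees \<open>u\<close> only through its derivatives, so the additive
      constant is free; \<open>1\<close> together with \<open>slope V \<ge> 0\<close> gives
      positivity.\<close>
    define u where "u x = 1 + integral {0..norm x} (slope V)" for x :: "real^'n"
    define v where "v x = 1 + integral {0..norm x} (avg CARD('n) (forcing V))" for x :: "real^'n"
    note lu = radial_lift[OF cVp u_def[unfolded slope_def]]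
    note lv = radial_lift[OF cF v_def]
    have vV: "v x = V (norm x)" for x using eq[of "norm x"] by (simp add: v_def)
    have "u x > 0" for x
    proof -
      have "integral {0..norm x} (slope V) \<ge> 0"
        using w0 by (intro integral_nonneg integrable_of_cont) (auto simp: slope_def intro!: avg_continuous N cVp)
      then show ?thesis by (simp add: u_def)
    qed
    moreover have "v x > 0" for x using V1[of "norm x"] by (simp add: vV)
    moreover have "laplacian v x = f (norm (grad u x))" for x
      using w0[of "norm x"] by (simp add: lv(3) lu(4) forcing_def slope_def)
    moreover have "laplacian u x = v x powr p" for x by (simp add: lu(3) vV)
    ultimately have "pos_rad_sol p f u v"
      unfolding pos_rad_sol_def using lu(1,2) lv(1,2) by blast
    then show "\<exists>u v :: real^'n \<Rightarrow> real. pos_rad_sol p f u v" by blast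
  qed
  ultimately show ?thesis by simp
qed

section \<open>Explicit constants and asymptotics for the power nonlinearity\<close>

lemma power_constants:
  fixes n p q :: real
  assumes n: "n \<ge> 1" and p: "p > 0" and q: "q > 0" and pq: "p * q < 1"
  defines "a \<equiv> (q + 2) / (1 - p * q)"
    and "A \<equiv> ((2+q) * (n*(1-p*q) + p*(2+q)) powr q * (n*(1-p*q) + q*(2*p+1)) / (1-p*q) powr (2+q)) powr (1/(p*q-1))"
  shows "a = q * (p * a + 1) + 2" "A > 0" "a > 0" "(A powr p / (n + p * a)) powr q / (n + a - 2) / a = A"
    "p * a + 2 = (2+2*p-p*q)/(1-p*q)"
    "A powr p / (n + p * a) / (p * a + 2) = 
       ((2+q) * (n*(1-p*q) + p*(2+q)) powr (1/p) * (n*(1-p*q) + q*(2*p+1))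
                  / ((1-p*q) powr ((2*p+2-p*q)/p) * (2+2*p-p*q) powr ((p*q-1)/p))) powr (p/(p*q-1))"
proof -
  define d where "d = 1 - p * q"
  define P where "P = n * d + p * (2 + q)"
  define Q where "Q = n * d + q * (2 * p + 1)"
  define m where "m = 2 + 2 * p - p * q"
  \<comment> \<open>The bracket in the constant for \<open>v\<close>. It equals the product of all
    divisors in the fixed-point equation, which therefore reads \<open>A^(pq) / X = A\<close> and is
    solved by \<open>A = X^(-1/d)\<close>.\<close>
  define X where "X = (2 + q) * P powr q * Q / d powr (2 + q)"
  define z where "z = d / p"
  have d: "d > 0" using pq by (simp add: d_def)
  have P: "P > 0" using n d p q by (simp add: P_def add_pos_pos)
  have Q: "Q > 0" using n d p q by (simp add: Q_def add_pos_pos)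
  have m: "m > 0" using p pq by (simp add: m_def)
  have X: "X > 0" using P Q d q by (simp add: X_def)
  have ad: "a = (q + 2) / d" by (simp add: a_def d_def)
  have A: "A = X powr (- 1 / d)" by (simp add: A_def X_def P_def Q_def d_def minus_divide_right)
  show A0: "A > 0" using X by (simp add: A)
  show a0: "a > 0" using d q by (simp add: ad)
  have nP: "n + p * a = P / d" using d by (simp add: ad P_def field_simps)
  have nQ: "n + a - 2 = Q / d" using d by (simp add: ad Q_def field_simps) (simp add: d_def algebra_simps)
  have am: "p * a + 2 = m / d" using d by (simp add: ad m_def field_simps) (simp add: d_def algebra_simps)
  then show "p * a + 2 = (2+2*p-p*q)/(1-p*q)" by (simp add: m_def d_def)
  show "a = q * (p * a + 1) + 2" using d by (simp add: ad field_simps) (simp add: d_def algebra_simps)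
  have XX: "X = (P / d) powr q * (Q / d) * a"
    using P d by (simp add: X_def ad powr_divide powr_add power2_eq_square field_simps)
  have "(A powr p / (n + p * a)) powr q / (n + a - 2) / a = A powr (p * q) / X"
    unfolding nP nQ XX using P d A0 by (simp add: powr_divide powr_mult powr_powr)
  also have "\<dots> = X powr (- 1 / d * (p * q) - 1)"
    using X by (simp add: A powr_powr powr_diff)
  also have "- 1 / d * (p * q) - 1 = - 1 / d" proof -
    have "- 1 / d * (p * q) - 1 = - (p * q + d) / d" using d by (simp add: field_simps)
    also have "p * q + d = 1" by (simp add: d_def)
    finally show ?thesis .
  qed
  finally show "(A powr p / (n + p * a)) powr q / (n + a - 2) / a = A" by (simp add: A)
  \<comment> \<open>\<open>S\<close> is \<open>(n + p a) (p a + 2)\<close>, the divisor relating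
    \<open>A powr p\<close> to the constant for \<open>u\<close>. The bracket for \<open>u\<close>
    is \<open>X * S powr z\<close>, and the outer exponent \<open>- p / d = - 1 / z\<close> splits
    it into \<open>A powr p\<close> and \<open>1 / S\<close>.\<close>
  define S where "S = P / d * (m / d)"
  have S: "S > 0" using P d m by (simp add: S_def)
  have "(2 + q) * P powr (1 / p) * Q / (d powr ((2 * p + 2 - p * q) / p) * m powr ((p * q - 1) / p)) = X * S powr z"
  proof -
    have "1 / p = q + z" using p by (simp add: z_def d_def field_simps)
    moreover have "(2 * p + 2 - p * q) / p = (2 + q) + (z + z)" using p by (simp add: z_def d_def field_simps)
    moreover have "(p * q - 1) / p = - z" by (simp add: z_def d_def minus_divide_left)
    moreover have "d powr (z * 2) = d powr z * d powr z" by (simp add: powr_add[symmetric] mult.commute)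
    ultimately show ?thesis
      using P d m by (simp add: X_def S_def powr_divide powr_mult powr_add powr_minus field_simps)
  qed
  then have "((2 + q) * P powr (1 / p) * Q / (d powr ((2 * p + 2 - p * q) / p) * m powr ((p * q - 1) / p))) powr (p / (p * q - 1)) 
    = (X * S powr z) powr - (p / d)"
    by (simp add: d_def minus_divide_right)
  also have "\<dots> = X powr - (p / d) * S powr - 1"
    using X S p d by (simp add: powr_mult powr_powr z_def)
  also have "X powr - (p / d) = A powr p" by (simp add: A powr_powr)
  also have "A powr p * S powr - 1 = A powr p / S" using S by (simp add: powr_minus divide_inverse)
  also have "\<dots> = A powr p / (n + p * a) / (p * a + 2)"
    unfolding nP am S_def by simp
  finally show "A powr p / (n + p * a) / (p * a + 2) = 
       ((2+q) * (n*(1-p*q) + p*(2+q)) powr (1/p) * (n*(1-p*q) + q*(2*p+1))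
                  / ((1-p*q) powr ((2*p+2-p*q)/p) * (2+2*p-p*q) powr ((p*q-1)/p))) powr (p/(p*q-1))"
    by (simp add: P_def Q_def m_def d_def)
qed

lemma pos_rad_sol_power_asymptotics:
  fixes u v :: "real^'n \<Rightarrow> real"
  assumes p: "p > 0" and q: "q > 0" and pq: "p * q < 1" and f: "\<And>t. t \<ge> 0 \<Longrightarrow> f t = t powr q"
    and sol: "pos_rad_sol p f u v"
  shows "((\<lambda>x. u x / norm x powr ((2+2*p-p*q)/(1-p*q))) \<longlongrightarrow>
                 ((2+q) * (real CARD('n)*(1-p*q) + p*(2+q)) powr (1/p)
                   * (real CARD('n)*(1-p*q) + q*(2*p+1))
                  / ((1-p*q) powr ((2*p+2-p*q)/p) * (2+2*p-p*q) powr ((p*q-1)/p)))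
                 powr (p/(p*q-1))) at_infinity" (is ?U)
    and "((\<lambda>x. v x / norm x powr ((q+2)/(1-p*q))) \<longlongrightarrow>
                 ((2+q) * (real CARD('n)*(1-p*q) + p*(2+q)) powr q
                   * (real CARD('n)*(1-p*q) + q*(2*p+1))
                  / (1-p*q) powr (2+q))
                 powr (1/(p*q-1))) at_infinity" (is ?V)
proof -
  define N where "N = CARD('n)"
  define a where "a = (q + 2) / (1 - p * q)"
  define A where "A = ((2+q) * (N*(1-p*q) + p*(2+q)) powr q * (N*(1-p*q) + q*(2*p+1)) / (1-p*q) powr (2+q)) powr (1/(p*q-1))"
  have N: "N \<ge> 1" by (simp add: N_def Suc_leI)
  then have "real N \<ge> 1" by simp
  note const = power_constants[OF this p q pq, folded a_def A_def]
  interpret power_solution N p q a A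
    by unfold_locales (use N p q const in auto)
  define V where "V r = v (r *\<^sub>R axis undefined 1)" for r
  note ode = pos_rad_sol_ode[OF sol p, where k = undefined, folded V_def N_def]
  have w0: "avg N (\<lambda>s. V s powr p) s \<ge> 0" if "s \<ge> 0" for s
    using that p ode(2) by (intro avg_nonneg N continuous_on_powr_nonneg ode(1)) (auto simp: less_imp_le)
  have eq: "V r = V 0 + integral {0..r} (avg N (\<lambda>s. avg N (\<lambda>s. V s powr p) s powr q))" if r: "r \<ge> 0" for r
  proof -
    have "integral {0..r} (avg N (\<lambda>s. f (avg N (\<lambda>s. V s powr p) s))) = integral {0..r} (avg N (\<lambda>s. avg N (\<lambda>s. V s powr p) s powr q))"
      using w0 f by (intro integral_cong avg_cong) auto
    then show ?thesis using ode(5)[OF r] by simp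
  qed
  \<comment> \<open>Chosen so that \<open>A * R powr a = V 0 + A\<close>, which exceeds
    \<open>V 0\<close>.\<close>
  define R where "R = (V 0 / A + 1) powr (1 / a)"
  have VA: "V 0 / A + 1 > 0" using ode(2)[of 0] A by (simp add: add_pos_pos)
  then have R0: "R > 0" by (simp add: R_def)
  have "A * R powr a = V 0 + A" using VA A a_pos by (simp add: R_def powr_powr field_simps)
  then have R1: "A * R powr a > V 0" using A by simp
  have norm_top: "filterlim norm at_top (at_infinity :: (real^'n) filter)" by (rule filterlim_norm_at_top)
  note bounds = solution_gt_power[OF ode(1,2) eq R0 R1] solution_lt_shift[OF ode(1,2) eq R0 R1] solution_integral_bounds[OF ode(1,2) eq R0 R1]
  have "((\<lambda>r. (0 + V r) / r powr a) \<longlongrightarrow> A) at_top"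
    using bounds(1,2) R0 a_pos by (intro tendsto_of_shift_bounds[of R]) (auto intro: less_imp_le)
  from filterlim_compose[OF this norm_top]
  show ?V by (simp add: ode(3)[symmetric] A_def a_def N_def)
  have "((\<lambda>r. (u 0 + integral {0..r} (avg N (\<lambda>s. V s powr p))) / r powr (p * a + 2)) \<longlongrightarrow> b / (p * a + 2)) at_top"
    using bounds(3,4) R0 exponents by (intro tendsto_of_shift_bounds[of R]) auto
  from filterlim_compose[OF this norm_top]
  have "((\<lambda>x::real^'n. u x / norm x powr (p * a + 2)) \<longlongrightarrow> b / (p * a + 2)) at_infinity"
    by (simp add: ode(4)[symmetric])
  \<comment> \<open>\<open>b / (p * a + 2)\<close> is the constant identified in the last claim of
    \<open>power_constants\<close>; the exponent is rewritten separately.\<close>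
  then show ?U unfolding b_def const(6) unfolding const(5) N_def .
qed

theorem theorem2p6:
  fixes p :: real and f :: "real \<Rightarrow> real"
  assumes N2: "CARD('n::finite) \<ge> 2"
    and p0: "p > 0"
    and fC1: "\<exists>f'. (\<forall>t\<ge>0. (f has_real_derivative f' t) (at t within {0..})) \<and> continuous_on {0..} f'"
    and fmono: "mono_on {0..} f"
    and fpos: "\<forall>t>0. f t > 0"
  shows "((\<exists>u v :: real^'n \<Rightarrow> real. pos_rad_sol p f u v) \<longleftrightarrow>
           filterlim (\<lambda>T. integral {1..T}
              (\<lambda>s. (integral {0..s} (\<lambda>t. integral {0..t} f)) powr (-p/(2*p+1)))) at_top at_top)
      \<and> (\<forall>q::real. q \<ge> 1 \<and> 1 > p \<and> p*q < 1 \<and> (\<forall>t\<ge>0. f t = t powr q) \<and>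
           p*(q^2-4)/(1-p*q) \<le> 2*(real CARD('n) - 1) \<longrightarrow>
           (\<forall>u v :: real^'n \<Rightarrow> real. pos_rad_sol p f u v \<longrightarrow>
              ((\<lambda>x. u x / norm x powr ((2+2*p-p*q)/(1-p*q))) \<longlongrightarrow>
                 ((2+q) * (real CARD('n)*(1-p*q) + p*(2+q)) powr (1/p)
                   * (real CARD('n)*(1-p*q) + q*(2*p+1))
                  / ((1-p*q) powr ((2*p+2-p*q)/p) * (2+2*p-p*q) powr ((p*q-1)/p)))
                 powr (p/(p*q-1))) at_infinity
            \<and> ((\<lambda>x. v x / norm x powr ((q+2)/(1-p*q))) \<longlongrightarrow>
                 ((2+q) * (real CARD('n)*(1-p*q) + p*(2+q)) powr q
                   * (real CARD('n)*(1-p*q) + q*(2*p+1))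
                  / (1-p*q) powr (2+q))
                 powr (1/(p*q-1))) at_infinity))"
proof (intro conjI allI impI; (elim conjE)?)
  have cf: "continuous_on {0..} f"
    using fC1 by (metis DERIV_continuous atLeast_iff continuous_on_eq_continuous_within)
  show "(\<exists>u v :: real^'n \<Rightarrow> real. pos_rad_sol p f u v) \<longleftrightarrow>
           filterlim (\<lambda>T. integral {1..T}
              (\<lambda>s. (integral {0..s} (\<lambda>t. integral {0..t} f)) powr (-p/(2*p+1)))) at_top at_top"
    using fpos by (intro ex_pos_rad_sol_iff p0 cf fmono) auto
qed (use p0 in \<open>intro pos_rad_sol_power_asymptotics[where f = f]; simp\<close>)+

end
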